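(* Under the standing assumptions of the context, let $X$ be the solution of the killed McKean–Vlasov equation and $\nu_t(A)=\mathbb P(X_t\in A,\ t<\tau)$. Then for every $t\in(0,T]$ the sub-probability measure $\nu_t$ is absolutely continuous with respect to Lebesgue measure, with density $v(t,\cdot)$. Moreover, for every $p\in(1,\infty)$ and every $\varepsilon\in(0,T]$, $v(t,\cdot)\in L^p(\mathbb{R})$ for all $t\in(0,T]$ and $\sup_{t\in[\varepsilon,T]}\|v(t,\cdot)\|_{L^p(\mathbb{R})}<\infty$.
   Context: Standing assumptions. $T>0$; $(\Omega,\mathcal F,(\mathcal F_t),\mathbb P)$ is a filtered probability space carrying a one-dimensional Brownian motion $W$, an $\mathcal F_0$-measurable real random variable $X_0$ independent of $W$ with $\mathbb E|X_0|^2<\infty$ and law $\nu_0(dx)=\rho_0(x)dx$, $\rho_0\in L^2(\mathbb{R})\cap C_b(\mathbb{R})$, and a random variable $Z\sim\mathrm{Exp}(1)$ independent of $X_0$ and $W$. $\Delta$ is a cemetery state isolated from $\mathbb{R}$; functions on $\mathbb{R}$ are extended by $f(\Delta)=0$. $K:\mathbb{R}\to\mathbb{R}_+$ is a smooth mollifier: $K\in C^\infty$; $|K|\le M_K$, $|\nabla K|\le M_K'$, $|\nabla^2K|\le M_K''$; $K$ and $\nabla K$ are Lipschitz with constants $L_K,L_K'$; $\int K=1$. Parameters $\lambda>0$, $c_0>0$, $\varphi_0>0$, $\varphi_1\in\mathbb{R}$ are such that there exist constants $0<m\le M$ with $m\le\varphi_0+\varphi_1c_0e^{-\lambda x}\le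 M$ for all $x\in[0,M_KT]$. The drift is $b(x,y):=-\varphi_1\lambda c_0\dfrac{e^{-\lambda x}y}{\varphi_0+\varphi_1c_0e^{-\lambda x}}$. For a finite measure $\nu$ on $\mathbb{R}$, $K*\nu(x):=\int K(x-y)\nu(dy)$, $\nabla K*\nu(x):=\int\nabla K(x-y)\nu(dy)$. The killed McKean–Vlasov equation is: $X_t=X_0+\int_0^t b(\int_0^sK*\nu_r(X_s)dr,\int_0^s\nabla K*\nu_r(X_s)dr)ds+\sqrt2W_t$ for $t\in[0,\tau)\cap[0,T]$, $X_t=\Delta$ for $t\ge\tau$, where $\nu_t(A)=\mathbb P(X_t\in A,t<\tau)$ and $\tau:=\inf\{t\ge0:\int_0^t\lambda c_0\exp(-\lambda\int_0^sK*\nu_r(X_s)dr)ds\ge Z\}$; it has a pathwise unique strong solution. *)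

theory Defs
  imports "HOL-Probability.Probability"
begin

definition brownian_motion :: "'a measure \<Rightarrow> (real \<Rightarrow> 'a \<Rightarrow> real) \<Rightarrow> bool" where
  "brownian_motion M W \<longleftrightarrow>
     prob_space M \<and>
     (\<forall>t. W t \<in> borel_measurable M) \<and>
     (AE \<omega> in M. W 0 \<omega> = 0 \<and> continuous_on {0..} (\<lambda>t. W t \<omega>)) \<and>
     (\<forall>s t. 0 \<le> s \<and> s < t \<longrightarrow>
        distributed M lborel (\<lambda>\<omega>. W t \<omega> - W s \<omega>)
          (\<lambda>x. ennreal (normal_density 0 (sqrt (t - s)) x))) \<and>
     (\<forall>ts :: real list. sorted ts \<and> distinct ts \<and> (\<forall>t\<in>set ts. 0 \<le> t) \<longrightarrow>
        prob_space.indep_vars M (\<lambda>_. borel)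
          (\<lambda>i \<omega>. W (ts ! Suc i) \<omega> - W (ts ! i) \<omega>) {..<length ts - 1})"

text \<open>Extension of a real function to the cemetery state: the cemetery
  \<Delta> is represented by None, a real state x by Some x, and f(\<Delta>) = 0.\<close>
definition ext_cem :: "(real \<Rightarrow> real) \<Rightarrow> real option \<Rightarrow> real" where
  "ext_cem f xo = (case xo of None \<Rightarrow> 0 | Some x \<Rightarrow> f x)"

text \<open>The sub-probability law nu_t(A) = P(X_t \<in> A, t < tau) = P(X_t \<in> A)
  for Borel A \<subseteq> \<real> (X_t = \<Delta> iff t \<ge> tau).\<close>
definition killed_law :: "'a measure \<Rightarrow> (real \<Rightarrow> 'a \<Rightarrow> real option) \<Rightarrow> real \<Rightarrow> real measure" where
  "killed_law M X t =
     measure_of UNIV (sets borel) (\<lambda>A. emeasure M {\<omega> \<in> space M. X t \<omega> \<in> Some ` A})"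

definition conv_meas :: "(real \<Rightarrow> real) \<Rightarrow> real measure \<Rightarrow> real \<Rightarrow> real" where
  "conv_meas K \<nu> x = (\<integral>y. K (x - y) \<partial>\<nu>)"

definition drift_b :: "real \<Rightarrow> real \<Rightarrow> real \<Rightarrow> real \<Rightarrow> real \<Rightarrow> real \<Rightarrow> real" where
  "drift_b lam c0 phi0 phi1 x y =
     - phi1 * lam * c0 * (exp (- lam * x) * y) / (phi0 + phi1 * c0 * exp (- lam * x))"

text \<open>The killed McKean--Vlasov equation on [0,T], path by path: X is a
  process with values in \<real> \<union> {\<Delta>} (real option), tau the killing time
  (as an extended real, Inf {} = \<infinity>).\<close>
definition killed_MV_solution ::
  "'a measure \<Rightarrow> real \<Rightarrow> (real \<Rightarrow> real) \<Rightarrow> real \<Rightarrow> real \<Rightarrow> real \<Rightarrow> real \<Rightarrow>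
   ('a \<Rightarrow> real) \<Rightarrow> (real \<Rightarrow> 'a \<Rightarrow> real) \<Rightarrow> ('a \<Rightarrow> real) \<Rightarrow>
   (real \<Rightarrow> 'a \<Rightarrow> real option) \<Rightarrow> ('a \<Rightarrow> ereal) \<Rightarrow> bool" where
  "killed_MV_solution M T K lam c0 phi0 phi1 X0 W Z X \<tau> \<longleftrightarrow>
    (let \<nu> = killed_law M X;
         A = (\<lambda>s \<omega>. ext_cem (\<lambda>x. integral {0..s} (\<lambda>r. conv_meas K (\<nu> r) x)) (X s \<omega>));
         B = (\<lambda>s \<omega>. ext_cem (\<lambda>x. integral {0..s} (\<lambda>r. conv_meas (deriv K) (\<nu> r) x)) (X s \<omega>))
     in (\<forall>t\<in>{0..T}. \<forall>S\<in>sets borel. {\<omega> \<in> space M. X t \<omega> \<in> Some ` S} \<in> sets M) \<and>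
        (AE \<omega> in M.
          \<tau> \<omega> = Inf {ereal t | t. t \<in> {0..T} \<and>
                    integral {0..t} (\<lambda>s. lam * c0 * exp (- lam * A s \<omega>)) \<ge> Z \<omega>} \<and>
          (\<forall>t\<in>{0..T}.
             (ereal t < \<tau> \<omega> \<longrightarrow>
                X t \<omega> = Some (X0 \<omega>
                   + integral {0..t} (\<lambda>s. drift_b lam c0 phi0 phi1 (A s \<omega>) (B s \<omega>))
                   + sqrt 2 * W t \<omega>)) \<and>
             (\<tau> \<omega> \<le> ereal t \<longrightarrow> X t \<omega> = None))))"

end

theory Submission
  imports Defs
begin

text \<open>
  On \<open>t < \<tau>\<close> the process solves \<open>X' = g(s, X) + \<surd>2 W'\<close> with additive noise and a drift \<open>g\<close> that is
  Lipschitz in both variables. For a frozen Brownian path the flow \<open>X0 \<mapsto> X t\<close> is therefore expansive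
  up to the factor \<open>exp (- t L)\<close>, and since \<open>X0\<close> is independent of \<open>W\<close> with bounded density, \<open>X t\<close>
  inherits a density bounded uniformly in \<open>t\<close>; no stochastic calculus is involved. The bound is
  obtained for the explicit Euler scheme, whose measurability is evident, and passes to the limit by
  Fatou. A density \<open>v \<le> C\<close> of mass at most one satisfies \<open>v\<^sup>p \<le> C\<^sup>p\<^sup>-\<^sup>1 v\<close>, which bounds every
  \<open>L\<^sup>p\<close> norm.

  The time integrals in the equation are Henstock--Kurzweil integrals with value 0 on non-integrable
  functions. Integrability of \<open>r \<mapsto> K * \<nu>\<^sub>r(x)\<close> is derived from the fact that almost every path, however
  irregular its drift, has one-sided limits, which is preserved by taking expectations.
\<close>

subsection \<open>Functions with one-sided limits\<close>

text \<open>The values of \<open>f\<close> are not tied to its one-sided limits, so jumps caused by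
  the killing, or by an integral falling to its default value, stay inside the class.\<close>

definition regulated_on :: "real \<Rightarrow> real \<Rightarrow> (real \<Rightarrow> real) \<Rightarrow> bool" where
  "regulated_on a b f \<longleftrightarrow>
     (\<forall>x\<in>{a..<b}. \<exists>l. (f \<longlongrightarrow> l) (at_right x)) \<and> (\<forall>x\<in>{a<..b}. \<exists>l. (f \<longlongrightarrow> l) (at_left x))"

lemma regulated_on_right:
  assumes "regulated_on a b f" "x \<in> {a..<b}"
  obtains l where "(f \<longlongrightarrow> l) (at_right x)"
  using assms unfolding regulated_on_def by blast

lemma regulated_on_left:
  assumes "regulated_on a b f" "x \<in> {a<..b}"
  obtains l where "(f \<longlongrightarrow> l) (at_left x)"
  using assms unfolding regulated_on_def by blast

lemma regulated_on_subinterval: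
  "regulated_on a b f \<Longrightarrow> a \<le> c \<Longrightarrow> d \<le> b \<Longrightarrow> regulated_on c d f"
  by (force simp: regulated_on_def)

lemma eventually_at_right_within:
  fixes x b :: real
  assumes "x < b" "\<And>y. x < y \<Longrightarrow> y < b \<Longrightarrow> P y"
  shows "eventually P (at_right x)"
  using assms by (auto simp: eventually_at_right_field)

lemma eventually_at_left_within:
  fixes x a :: real
  assumes "a < x" "\<And>y. a < y \<Longrightarrow> y < x \<Longrightarrow> P y"
  shows "eventually P (at_left x)"
  using assms by (auto simp: eventually_at_left_field)

lemma regulated_on_cong:
  assumes "\<And>x. a \<le> x \<Longrightarrow> x \<le> b \<Longrightarrow> f x = g x"
  shows "regulated_on a b f \<longleftrightarrow> regulated_on a b g"
proof -
  have "(f \<longlongrightarrow> l) (at_right x) \<longleftrightarrow> (g \<longlongrightarrow> l) (at_right x)" if "x \<in> {a..<b}" for x l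
    by (rule tendsto_cong, rule eventually_at_right_within[of _ b]) (use that assms in auto)
  moreover have "(f \<longlongrightarrow> l) (at_left x) \<longleftrightarrow> (g \<longlongrightarrow> l) (at_left x)" if "x \<in> {a<..b}" for x l
    by (rule tendsto_cong, rule eventually_at_left_within[of a]) (use that assms in auto)
  ultimately show ?thesis by (simp add: regulated_on_def)
qed

lemma regulated_on_continuous:
  assumes "continuous_on {a..b} f"
  shows "regulated_on a b f"
proof -
  have "\<exists>l. (f \<longlongrightarrow> l) (at_right x)" if "x \<in> {a..<b}" for x
  proof -
    have "(f \<longlongrightarrow> f x) (at x within {a..b})"
      using assms that by (auto simp: continuous_on_def)
    then have "(f \<longlongrightarrow> f x) (at x within {x..b})"
      by (rule tendsto_within_subset) (use that in auto)
    with that show ?thesis by (metis at_within_Icc_at_right atLeastLessThan_iff)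
  qed
  moreover have "\<exists>l. (f \<longlongrightarrow> l) (at_left x)" if "x \<in> {a<..b}" for x
  proof -
    have "(f \<longlongrightarrow> f x) (at x within {a..b})"
      using assms that by (auto simp: continuous_on_def)
    then have "(f \<longlongrightarrow> f x) (at x within {a..x})"
      by (rule tendsto_within_subset) (use that in auto)
    with that show ?thesis by (metis at_within_Icc_at_left greaterThanAtMost_iff)
  qed
  ultimately show ?thesis by (simp add: regulated_on_def)
qed

lemma regulated_on_add:
  "regulated_on a b f \<Longrightarrow> regulated_on a b g \<Longrightarrow> regulated_on a b (\<lambda>x. f x + g x)"
  unfolding regulated_on_def by (blast intro: tendsto_add)

text \<open>A one-sided limit \<open>l\<close> of \<open>f\<close> at \<open>x\<close> sends the
  pairs \<open>(s, f s)\<close> to \<open>(x, l)\<close>. Since \<open>l\<close> need not be a value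
  of \<open>f\<close>, continuity of \<open>h\<close> is asked on the whole strip.\<close>

lemma regulated_on_compose2:
  assumes f: "regulated_on a b f"
    and cont: "continuous_on ({a..b} \<times> UNIV) (\<lambda>p. h (fst p) (snd p))"
  shows "regulated_on a b (\<lambda>s. h s (f s))"
proof -
  have "\<exists>l. ((\<lambda>s. h s (f s)) \<longlongrightarrow> l) (at_right x)" if x: "x \<in> {a..<b}" for x
  proof -
    obtain l where "(f \<longlongrightarrow> l) (at_right x)" using regulated_on_right[OF f x] .
    then have "((\<lambda>s. (s, f s)) \<longlongrightarrow> (x, l)) (at_right x)" by (intro tendsto_intros)
    from continuous_on_tendsto_compose[OF cont this]
    have "((\<lambda>s. h s (f s)) \<longlongrightarrow> h x l) (at_right x)"
      using x by (force intro: eventually_at_right_within[of _ b])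
    then show ?thesis ..
  qed
  moreover have "\<exists>l. ((\<lambda>s. h s (f s)) \<longlongrightarrow> l) (at_left x)" if x: "x \<in> {a<..b}" for x
  proof -
    obtain l where "(f \<longlongrightarrow> l) (at_left x)" using regulated_on_left[OF f x] .
    then have "((\<lambda>s. (s, f s)) \<longlongrightarrow> (x, l)) (at_left x)" by (intro tendsto_intros)
    from continuous_on_tendsto_compose[OF cont this]
    have "((\<lambda>s. h s (f s)) \<longlongrightarrow> h x l) (at_left x)"
      using x by (force intro: eventually_at_left_within[of a])
    then show ?thesis ..
  qed
  ultimately show ?thesis by (simp add: regulated_on_def)
qed

lemma regulated_on_compose:
  assumes "regulated_on a b f" "continuous_on UNIV h"
  shows "regulated_on a b (\<lambda>s. h (f s))"
  by (intro regulated_on_compose2[OF assms(1)] continuous_on_compose2[OF assms(2)]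
      continuous_on_snd continuous_on_id) auto

text \<open>On either side of a point the cut function is locally \<open>f\<close> or locally 0.
  From the right this is decided by \<open>x < \<tau>\<close>, from the left by
  \<open>x \<le> \<tau>\<close>, since then all earlier times precede \<open>\<tau>\<close>.\<close>

lemma regulated_on_kill:
  fixes \<tau> :: ereal
  assumes "regulated_on a b f"
  shows "regulated_on a b (\<lambda>s. if ereal s < \<tau> then f s else 0)"
proof -
  let ?g = "\<lambda>s. if ereal s < \<tau> then f s else 0"
  have "\<exists>l. (?g \<longlongrightarrow> l) (at_right x)" if x: "x \<in> {a..<b}" for x
  proof (cases "ereal x < \<tau>")
    case True
    then obtain c where c: "x < c" "ereal c < \<tau>" using ereal_dense2[of "ereal x" \<tau>] by auto
    obtain l where l: "(f \<longlongrightarrow> l) (at_right x)" using regulated_on_right[OF assms x] .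
    have ev: "eventually (\<lambda>s. ?g s = f s) (at_right x)"
      by (rule eventually_at_right_within[OF c(1)]) (use less_trans[OF _ c(2)] in simp)
    show ?thesis using tendsto_cong[OF ev, THEN iffD2, OF l] ..
  next
    case False
    have "\<not> ereal y < \<tau>" if "x < y" for y
      using less_trans[of "ereal x" "ereal y" \<tau>] that False by auto
    then have "eventually (\<lambda>s. ?g s = 0) (at_right x)"
      by (intro eventually_at_right_within[of _ "x+1"]) auto
    then have "(?g \<longlongrightarrow> 0) (at_right x)" by (rule tendsto_eventually)
    then show ?thesis ..
  qed
  moreover have "\<exists>l. (?g \<longlongrightarrow> l) (at_left x)" if x: "x \<in> {a<..b}" for x
  proof (cases "ereal x \<le> \<tau>")
    case True
    obtain l where l: "(f \<longlongrightarrow> l) (at_left x)" using regulated_on_left[OF assms x] .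
    have "ereal y < \<tau>" if "y < x" for y
      using less_le_trans[of "ereal y" "ereal x" \<tau>] that True by simp
    then have ev: "eventually (\<lambda>s. ?g s = f s) (at_left x)"
      by (intro eventually_at_left_within[of "x-1"]) auto
    show ?thesis using tendsto_cong[OF ev, THEN iffD2, OF l] ..
  next
    case False
    then obtain c where c: "c < x" "\<tau> < ereal c" using ereal_dense2[of \<tau> "ereal x"] by (auto simp: not_le)
    have "\<not> ereal y < \<tau>" if "c < y" for y
      using less_trans[of "ereal c" "ereal y" \<tau>] that c(2) by auto
    then have "eventually (\<lambda>s. ?g s = 0) (at_left x)"
      by (intro eventually_at_left_within[OF c(1)]) auto
    then have "(?g \<longlongrightarrow> 0) (at_left x)" by (rule tendsto_eventually)
    then show ?thesis ..
  qed
  ultimately show ?thesis by (simp add: regulated_on_def)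
qed

text \<open>Uniform limits of integrable functions are integrable. Close to a point,
  \<open>f\<close> is within \<open>e\<close> of one constant on each side, and bisection glues
  these local approximants together.\<close>

lemma regulated_on_integrable:
  assumes f: "regulated_on a b f"
  shows "f integrable_on {a..b}"
proof (cases "a \<le> b")
  case True
  have "\<exists>g. (\<forall>x\<in>cbox a b. norm (f x - g x) \<le> e) \<and> g integrable_on cbox a b" if e: "0 < e" for e
  proof -
    \<comment> \<open>The guard is there because \<open>Bolzano\<close> asks the local property of
      all short intervals around \<open>x\<close>, including those that leave
      \<open>{a..b}\<close>.\<close>
    define P where "P u v \<longleftrightarrow> (a \<le> u \<and> u \<le> v \<and> v \<le> b \<longrightarrow>
      (\<exists>g. (\<forall>x\<in>{u..v}. norm (f x - g x) \<le> e) \<and> g integrable_on {u..v}))" for u v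
    have "P a b" using True
    proof (induction rule: Bolzano)
      case (trans u v w)
      show ?case unfolding P_def
      proof
        assume *: "a \<le> u \<and> u \<le> w \<and> w \<le> b"
        from * trans obtain g where g: "\<And>x. x\<in>{u..v} \<Longrightarrow> norm (f x - g x) \<le> e" "g integrable_on {u..v}"
          unfolding P_def by (meson order_trans)
        from * trans obtain h where h: "\<And>x. x\<in>{v..w} \<Longrightarrow> norm (f x - h x) \<le> e" "h integrable_on {v..w}"
          unfolding P_def by (meson order_trans)
        let ?k = "\<lambda>x. if x \<le> v then g x else h x"
        have "?k integrable_on {u..v}" by (rule integrable_eq[OF g(2)]) auto
        moreover have "?k integrable_on {v..w}"
          by (rule integrable_spike_finite[OF _ _ h(2), of "{v}"]) auto
        ultimately have "?k integrable_on {u..w}"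
          by (rule Henstock_Kurzweil_Integration.integrable_combine[OF trans(3,4)])
        moreover have "\<forall>x\<in>{u..w}. norm (f x - ?k x) \<le> e" using g(1) h(1) by auto
        ultimately show "\<exists>g. (\<forall>x\<in>{u..w}. norm (f x - g x) \<le> e) \<and> g integrable_on {u..w}" by (intro exI[of _ ?k]) auto
      qed
    next
      case (local x)
      have "\<exists>d l. d > 0 \<and> (\<forall>y. x < y \<and> y < x + d \<and> y \<le> b \<longrightarrow> norm (f y - l) \<le> e)"
      proof (cases "x < b")
        case True
        then obtain l where "(f \<longlongrightarrow> l) (at_right x)" using regulated_on_right[OF f] local by auto
        then have "eventually (\<lambda>y. dist (f y) l < e) (at_right x)" using e tendstoD by blast
        then obtain c where c: "c > x" "\<And>y. x < y \<Longrightarrow> y < c \<Longrightarrow> dist (f y) l < e"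
          by (auto simp: eventually_at_right_field)
        then show ?thesis
          by (intro exI[of _ "c - x"] exI[of _ l]) (auto simp: dist_norm intro!: less_imp_le)
      qed (auto intro: exI[of _ 1])
      then obtain d1 l1 where 1: "d1 > 0" "\<And>y. x < y \<Longrightarrow> y < x + d1 \<Longrightarrow> y \<le> b \<Longrightarrow> norm (f y - l1) \<le> e"
        by blast
      have "\<exists>d l. d > 0 \<and> (\<forall>y. y < x \<and> x - d < y \<and> a \<le> y \<longrightarrow> norm (f y - l) \<le> e)"
      proof (cases "a < x")
        case True
        then obtain l where "(f \<longlongrightarrow> l) (at_left x)" using regulated_on_left[OF f] local by auto
        then have "eventually (\<lambda>y. dist (f y) l < e) (at_left x)" using e tendstoD by blast
        then obtain c where c: "c < x" "\<And>y. c < y \<Longrightarrow> y < x \<Longrightarrow> dist (f y) l < e"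
          by (auto simp: eventually_at_left_field)
        then show ?thesis
          by (intro exI[of _ "x - c"] exI[of _ l]) (auto simp: dist_norm intro!: less_imp_le)
      qed (auto intro: exI[of _ 1])
      then obtain d2 l2 where 2: "d2 > 0" "\<And>y. y < x \<Longrightarrow> x - d2 < y \<Longrightarrow> a \<le> y \<Longrightarrow> norm (f y - l2) \<le> e"
        by blast
      have "P u v" if uv: "u \<le> x \<and> x \<le> v \<and> v - u < min d1 d2" for u v
        unfolding P_def
      proof
        assume *: "a \<le> u \<and> u \<le> v \<and> v \<le> b"
        \<comment> \<open>The value at \<open>x\<close> is copied exactly, as \<open>f x\<close> may
          be far from both \<open>l1\<close> and \<open>l2\<close>; a single point does not affect
          integrability.\<close>
        let ?g = "\<lambda>y. if y < x then l2 else if y = x then f x else l1"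
        have "?g integrable_on {u..x}"
          by (rule integrable_spike_finite[of "{x}" _ _ "\<lambda>_. l2"]) auto
        moreover have "?g integrable_on {x..v}"
          by (rule integrable_spike_finite[of "{x}" _ _ "\<lambda>_. l1"]) auto
        ultimately have "?g integrable_on {u..v}"
          using uv by (intro Henstock_Kurzweil_Integration.integrable_combine[of u x v]) auto
        moreover have "norm (f y - ?g y) \<le> e" if "y \<in> {u..v}" for y
          using that uv * 1(2)[of y] 2(2)[of y] e by auto
        ultimately show "\<exists>g. (\<forall>x\<in>{u..v}. norm (f x - g x) \<le> e) \<and> g integrable_on {u..v}" by (intro exI[of _ ?g]) auto
      qed
      then show ?case using 1(1) 2(1) by (intro exI[of _ "min d1 d2"]) auto
    qed
    then show ?thesis using True by (simp add: P_def)
  qed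
  then have "f integrable_on cbox a b" by (rule integrable_uniform_limit)
  then show ?thesis by simp
qed (simp add: integrable_on_empty)

text \<open>If \<open>f\<close> is not integrable the integral is 0, and the bound persists because
  \<open>B\<close> is nonnegative.\<close>

lemma integral_abs_le:
  fixes f :: "real \<Rightarrow> real"
  assumes "a \<le> b" "\<And>x. x \<in> {a..b} \<Longrightarrow> \<bar>f x\<bar> \<le> B"
  shows "\<bar>integral {a..b} f\<bar> \<le> B * (b - a)"
proof (cases "f integrable_on {a..b}")
  case True
  have "0 \<le> B" using assms(2)[of a] assms(1) by auto
  then have "norm (integral (cbox a b) f) \<le> B * Henstock_Kurzweil_Integration.content (cbox a b)"
    by (rule has_integral_bound[OF _ integrable_integral]) (use True assms in auto)
  then show ?thesis using assms by simp
next
  case False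
  have "0 \<le> B" using assms(2)[of a] assms(1) by auto
  with False assms show ?thesis by (simp add: not_integrable_integral)
qed

lemma integral_diff_le:
  fixes f :: "real \<Rightarrow> real"
  assumes "f integrable_on {a..y}" "a \<le> x" "x \<le> y" "\<And>s. s \<in> {a..y} \<Longrightarrow> \<bar>f s\<bar> \<le> B"
  shows "\<bar>integral {a..y} f - integral {a..x} f\<bar> \<le> B * (y - x)"
proof -
  have "integral {a..x} f + integral {x..y} f = integral {a..y} f"
    by (rule Henstock_Kurzweil_Integration.integral_combine) (use assms in auto)
  moreover have "\<bar>integral {x..y} f\<bar> \<le> B * (y - x)"
    by (rule integral_abs_le) (use assms in auto)
  ultimately show ?thesis by linarith
qed

text \<open>No integrability is assumed: where \<open>f\<close> is not integrable on \<open>{a..s}\<close> the integral has the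
  junk value 0, which costs one additional jump at most.\<close>
lemma regulated_on_integral:
  fixes f :: "real \<Rightarrow> real"
  assumes B: "\<And>s. s \<in> {a..b} \<Longrightarrow> \<bar>f s\<bar> \<le> B"
  shows "regulated_on a b (\<lambda>s. integral {a..s} f)"
proof -
  let ?I = "\<lambda>s. integral {a..s} f"
  have "\<exists>l. (?I \<longlongrightarrow> l) (at_right x)" if x: "x \<in> {a..<b}" for x
  proof (cases "\<exists>y>x. y \<le> b \<and> f integrable_on {a..y}")
    case True
    then obtain y where y: "x < y" "y \<le> b" "f integrable_on {a..y}" by auto
    have "regulated_on a y ?I"
      by (intro regulated_on_continuous indefinite_integral_continuous_1 y)
    then show ?thesis using x y by (auto simp: regulated_on_def)
  next
    case False
    have "eventually (\<lambda>s. ?I s = 0) (at_right x)"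
      by (rule eventually_at_right_within[of _ b]) (use False x in \<open>auto simp: not_integrable_integral\<close>)
    then have "(?I \<longlongrightarrow> 0) (at_right x)" by (rule tendsto_eventually)
    then show ?thesis ..
  qed
  moreover have "\<exists>l. (?I \<longlongrightarrow> l) (at_left x)" if x: "x \<in> {a<..b}" for x
  \<comment> \<open>Non-integrability on \<open>{a..y}\<close> passes to every larger interval, so
    the integral is then 0 between \<open>y\<close> and \<open>x\<close>. Otherwise it is genuine
    everywhere left of \<open>x\<close>, hence Lipschitz there, and a uniformly continuous function
    extends to the closure.\<close>
  proof (cases "\<exists>y. a \<le> y \<and> y < x \<and> \<not> f integrable_on {a..y}")
    case True
    then obtain y where y: "a \<le> y" "y < x" "\<not> f integrable_on {a..y}" by auto
    have "?I s = 0" if "y < s" "s < x" for s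
      using y that integrable_on_subinterval[of f "{a..s}" a y]
      by (auto intro!: not_integrable_integral)
    then have "eventually (\<lambda>s. ?I s = 0) (at_left x)"
      using y by (intro eventually_at_left_within[of y]) auto
    then have "(?I \<longlongrightarrow> 0) (at_left x)" by (rule tendsto_eventually)
    then show ?thesis ..
  next
    case False
    have "0 \<le> B" using B[of a] x by auto
    have "\<bar>?I u - ?I v\<bar> \<le> B * \<bar>u - v\<bar>" if "u \<in> {a..<x}" "v \<in> {a..<x}" for u v
    proof (cases "u \<le> v")
      case True
      then show ?thesis using that False integral_diff_le[of f a v u B] B x
        by (auto simp: abs_minus_commute)
    next
      case False': False
      then show ?thesis using that False integral_diff_le[of f a u v B] B x by auto
    qed
    then have "B-lipschitz_on {a..<x} ?I"
      using \<open>0 \<le> B\<close> by (intro lipschitz_onI) (auto simp: dist_real_def)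
    then have "uniformly_continuous_on {a..<x} ?I"
      by (rule lipschitz_on_uniformly_continuous)
    moreover have "x \<in> closure {a..<x}" using x by simp
    ultimately obtain l where "(?I \<longlongrightarrow> l) (at x within {a..<x})"
      by (rule uniformly_continuous_on_extension_at_closure)
    moreover have "at x within {a..<x} = at_left x"
      using x by (intro at_within_nhd[of x "{a<..}"]) auto
    ultimately show ?thesis by auto
  qed
  ultimately show ?thesis by (simp add: regulated_on_def)
qed

text \<open>Dominated convergence along monotone sequences tending to the point, with a constant as
  integrable majorant.\<close>

lemma (in prob_space) regulated_on_expectation:
  assumes F: "\<And>r. r \<in> {a..b} \<Longrightarrow> F r \<in> borel_measurable M"
    and B: "\<And>r \<omega>. r \<in> {a..b} \<Longrightarrow> \<omega> \<in> space M \<Longrightarrow> \<bar>F r \<omega>\<bar> \<le> B"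
    and reg: "AE \<omega> in M. regulated_on a b (\<lambda>r. F r \<omega>)"
  shows "regulated_on a b (\<lambda>r. expectation (F r))"
proof -
  obtain N where N: "N \<in> null_sets M" "{\<omega> \<in> space M. \<not> regulated_on a b (\<lambda>r. F r \<omega>)} \<subseteq> N"
    using reg unfolding eventually_ae_filter by blast
  define G where "G r \<omega> = (if \<omega> \<in> space M - N then F r \<omega> else 0)" for r \<omega>
  have G_meas: "G r \<in> borel_measurable M" if "r \<in> {a..b}" for r
    unfolding G_def using F[OF that] null_setsD2[OF N(1)] by measurable
  have G_bdd: "\<bar>G r \<omega>\<bar> \<le> \<bar>B\<bar>" if "r \<in> {a..b}" for r \<omega>
    using B[OF that, of \<omega>] by (auto simp: G_def)
  have G_eq: "expectation (G r) = expectation (F r)" if "r \<in> {a..b}" for r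
    by (rule integral_cong_AE[OF G_meas[OF that] F[OF that]])
       (use AE_not_in[OF N(1)] AE_space in eventually_elim, simp add: G_def)
  have G_reg: "regulated_on a b (\<lambda>r. G r \<omega>)" for \<omega>
  proof (cases "\<omega> \<in> space M - N")
    case True
    then show ?thesis using N(2) by (auto simp: G_def)
  next
    case False
    then have "(\<lambda>r. G r \<omega>) = (\<lambda>r. 0)" by (auto simp: G_def)
    then show ?thesis by (simp add: regulated_on_continuous)
  qed
  have seq: "(\<lambda>n. expectation (G (S n))) \<longlonglongrightarrow> expectation H"
    if S: "\<And>n. S n \<in> {a..b}" "\<And>\<omega>. (\<lambda>n. G (S n) \<omega>) \<longlonglongrightarrow> H \<omega>" for S H
  proof (rule integral_dominated_convergence[where w="\<lambda>_. \<bar>B\<bar>"])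
    show "H \<in> borel_measurable M"
      by (rule borel_measurable_LIMSEQ_real[of _ "\<lambda>n. G (S n)"]) (use S G_meas in auto)
  qed (use S G_meas G_bdd in auto)
  have "regulated_on a b (\<lambda>r. expectation (G r))"
    unfolding regulated_on_def
  proof safe
    fix x assume x: "x \<in> {a..<b}"
    then have "\<forall>\<omega>. \<exists>l. ((\<lambda>r. G r \<omega>) \<longlongrightarrow> l) (at_right x)" using G_reg by (auto simp: regulated_on_def)
    then obtain H where H: "\<And>\<omega>. ((\<lambda>r. G r \<omega>) \<longlongrightarrow> H \<omega>) (at_right x)" by metis
    have "((\<lambda>r. expectation (G r)) \<longlongrightarrow> expectation H) (at_right x)"
    proof (rule tendsto_at_right_sequentially[of _ b])
      show "x < b" using x by simp
    next
      fix S :: "nat \<Rightarrow> real" assume S: "\<And>n. x < S n" "\<And>n. S n < b" "decseq S" "S \<longlonglongrightarrow> x"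
      have "filterlim S (at_right x) sequentially"
        using S(1,4) by (auto simp: filterlim_at intro!: always_eventually) (metis S(1) less_irrefl)?
      then have "(\<lambda>n. G (S n) \<omega>) \<longlonglongrightarrow> H \<omega>" for \<omega> using H filterlim_compose by blast
      moreover have Sab: "S n \<in> {a..b}" for n using S(1)[of n] S(2)[of n] x by auto
      ultimately show "(\<lambda>n. expectation (G (S n))) \<longlonglongrightarrow> expectation H"
        using seq[of S H] Sab by blast
    qed
    then show "\<exists>l. ((\<lambda>r. expectation (G r)) \<longlongrightarrow> l) (at_right x)" ..
  next
    fix x assume x: "x \<in> {a<..b}"
    then have "\<forall>\<omega>. \<exists>l. ((\<lambda>r. G r \<omega>) \<longlongrightarrow> l) (at_left x)" using G_reg by (auto simp: regulated_on_def)
    then obtain H where H: "\<And>\<omega>. ((\<lambda>r. G r \<omega>) \<longlongrightarrow> H \<omega>) (at_left x)" by metis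
    have "((\<lambda>r. expectation (G r)) \<longlongrightarrow> expectation H) (at_left x)"
    proof (rule tendsto_at_left_sequentially[of a])
      show "a < x" using x by simp
    next
      fix S :: "nat \<Rightarrow> real" assume S: "\<And>n. S n < x" "\<And>n. a < S n" "incseq S" "S \<longlonglongrightarrow> x"
      have "filterlim S (at_left x) sequentially"
        using S(1,4) by (auto simp: filterlim_at intro!: always_eventually) (metis S(1) less_irrefl)?
      then have "(\<lambda>n. G (S n) \<omega>) \<longlonglongrightarrow> H \<omega>" for \<omega> using H filterlim_compose by blast
      moreover have Sab: "S n \<in> {a..b}" for n using S(1)[of n] S(2)[of n] x by auto
      ultimately show "(\<lambda>n. expectation (G (S n))) \<longlonglongrightarrow> expectation H"
        using seq[of S H] Sab by blast
    qed
    then show "\<exists>l. ((\<lambda>r. expectation (G r)) \<longlongrightarrow> l) (at_left x)" ..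
  qed
  then show ?thesis by (subst regulated_on_cong[OF G_eq[symmetric]]) auto
qed

subsection \<open>Measures dominated by Lebesgue measure\<close>

text \<open>By outer regularity \<open>S\<close> is covered by countably many non-overlapping closed
  intervals of total length at most its Lebesgue measure plus \<open>e\<close>. The bound on
  intervals is summed over the cover, and \<open>e\<close> tends to 0.\<close>

lemma emeasure_le_lborel_bounded:
  fixes \<nu> :: "real measure"
  assumes sets: "sets \<nu> = sets borel" and C: "0 \<le> C"
    and bound: "\<And>a b. a \<le> b \<Longrightarrow> emeasure \<nu> {a..b} \<le> ennreal (C * (b - a))"
    and S: "S \<in> sets borel" "S \<subseteq> {a..b}"
  shows "emeasure \<nu> S \<le> ennreal C * emeasure lborel S"
proof -
  have S_lm: "S \<in> lmeasurable"
    using S by (intro bounded_set_imp_lmeasurable) (auto intro: bounded_subset[of "{a..b}"])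
  have S_eq: "emeasure lborel S = ennreal (measure lebesgue S)"
    using S(1) emeasure_eq_measure2[OF S_lm] by simp
  have le: "emeasure \<nu> S \<le> ennreal (C * (measure lebesgue S + e))" if e: "0 < e" for e
  proof -
    have "S \<subseteq> cbox a b" using S(2) by simp
    then obtain \<D> where "countable \<D>"
        "\<And>K. K \<in> \<D> \<Longrightarrow> K \<subseteq> cbox a b \<and> K \<noteq> {} \<and> (\<exists>c d. K = cbox c d)"
        "pairwise (\<lambda>A B. interior A \<inter> interior B = {}) \<D>"
        "\<And>u v. cbox u v \<in> \<D> \<Longrightarrow> \<exists>n. \<forall>i \<in> Basis. v \<bullet> i - u \<bullet> i = (b \<bullet> i - a \<bullet> i)/2^n"
        "\<And>K. \<lbrakk>K \<in> \<D>; box a b \<noteq> {}\<rbrakk> \<Longrightarrow> interior K \<noteq> {}"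
        "S \<subseteq> \<Union>\<D>" "\<Union>\<D> \<in> lmeasurable" "measure lebesgue (\<Union>\<D>) \<le> measure lebesgue S + e"
      by (rule measurable_outer_intervals_bounded[OF S_lm _ e]) (rule that)
    note \<D> = this(1,2,3,6,7,8)
    have K: "\<exists>c d. c \<le> d \<and> K = {c..d}" if "K \<in> \<D>" for K
      using \<D>(2)[OF that] by (metis atLeastatMost_empty_iff cbox_interval)
    have borel_D: "K \<in> sets borel" if "K \<in> \<D>" for K using K[OF that] by auto
    have UD: "\<Union>\<D> \<in> sets borel" using \<D>(1) borel_D by blast
    \<comment> \<open>The intervals may share endpoints. Interiors have the same length and are
      pairwise disjoint, so that the lengths can be added by countable additivity.\<close>
    have le_K: "emeasure \<nu> K \<le> ennreal C * emeasure lborel (interior K)" if K_in: "K \<in> \<D>" for K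
    proof -
      obtain c d where cd: "c \<le> d" "K = {c..d}" using K[OF K_in] by auto
      have "emeasure \<nu> K \<le> ennreal (C * (d - c))" unfolding cd(2) by (rule bound[OF cd(1)])
      also have "\<dots> = ennreal C * emeasure lborel (interior K)"
        using cd C by (simp add: ennreal_mult'')
      finally show ?thesis .
    qed
    have "emeasure \<nu> S \<le> emeasure \<nu> (\<Union>\<D>)"
      by (rule emeasure_mono) (use \<D> UD sets in auto)
    also have "\<dots> = (\<integral>\<^sup>+x. indicator (\<Union>\<D>) x \<partial>\<nu>)" using UD sets by simp
    \<comment> \<open>Countable subadditivity, written as an integral over the counting measure on
      \<open>\<D>\<close>: the indicator of the union is at most the sum of the indicators, and the
      two integrals are exchanged.\<close>
    also have "\<dots> \<le> (\<integral>\<^sup>+x. (\<integral>\<^sup>+K. indicator K x \<partial>count_space \<D>) \<partial>\<nu>)"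
    proof (rule nn_integral_mono)
      fix x
      show "indicator (\<Union>\<D>) x \<le> (\<integral>\<^sup>+K. indicator K x \<partial>count_space \<D>)"
      proof (cases "x \<in> \<Union>\<D>")
        case True
        then obtain K where "K \<in> \<D>" "x \<in> K" by auto
        then show ?thesis
          using nn_integral_ge_point[of K \<D> "\<lambda>K. indicator K x :: ennreal"] by (auto simp: indicator_def)
      qed simp
    qed
    also have "\<dots> = (\<integral>\<^sup>+K. (\<integral>\<^sup>+x. indicator K x \<partial>\<nu>) \<partial>count_space \<D>)"
      by (rule nn_integral_count_space_nn_integral)
         (use \<D>(1) borel_D sets in \<open>auto intro!: borel_measurable_indicator\<close>)
    also have "\<dots> \<le> (\<integral>\<^sup>+K. ennreal C * emeasure lborel (interior K) \<partial>count_space \<D>)"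
      by (rule nn_integral_mono) (use le_K borel_D sets in auto)
    also have "\<dots> = ennreal C * (\<integral>\<^sup>+K. emeasure lborel (interior K) \<partial>count_space \<D>)"
      by (rule nn_integral_cmult) simp
    also have "(\<integral>\<^sup>+K. emeasure lborel (interior K) \<partial>count_space \<D>) = emeasure lborel (\<Union>K\<in>\<D>. interior K)"
      using \<D>(1,3)
      by (intro emeasure_UN_countable[symmetric]) (auto simp: disjoint_family_on_def pairwise_def)
    also have "\<dots> \<le> emeasure lborel (\<Union>\<D>)"
      by (rule emeasure_mono) (use UD interior_subset in auto)
    also have "\<dots> = ennreal (measure lebesgue (\<Union>\<D>))"
      using UD emeasure_eq_measure2[OF \<D>(5)] by simp
    also have "ennreal C * \<dots> \<le> ennreal C * ennreal (measure lebesgue S + e)"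
      using \<D>(6) by (intro mult_left_mono ennreal_leI) auto
    also have "\<dots> = ennreal (C * (measure lebesgue S + e))"
      using C e by (simp add: ennreal_mult'')
    finally show ?thesis by (simp add: mult_left_mono)
  qed
  have "((\<lambda>e. ennreal (C * (measure lebesgue S + e))) \<longlongrightarrow> ennreal (C * (measure lebesgue S + 0))) (at_right 0)"
    by (intro tendsto_intros)
  then have "emeasure \<nu> S \<le> ennreal (C * (measure lebesgue S + 0))"
    by (rule tendsto_lowerbound) (use le in \<open>auto simp: eventually_at_right_less eventually_at_filter\<close>)
  then show ?thesis using C by (simp add: S_eq ennreal_mult'')
qed

lemma emeasure_le_lborel:
  fixes \<nu> :: "real measure"
  assumes sets: "sets \<nu> = sets borel" and C: "0 \<le> C"
    and bound: "\<And>a b. a \<le> b \<Longrightarrow> emeasure \<nu> {a..b} \<le> ennreal (C * (b - a))"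
    and S: "S \<in> sets borel"
  shows "emeasure \<nu> S \<le> ennreal C * emeasure lborel S"
proof -
  let ?S = "\<lambda>k::nat. S \<inter> {- real k..real k}"
  have "(\<Union>k. ?S k) = S"
  proof safe
    fix x assume "x \<in> S"
    moreover obtain k where "\<bar>x\<bar> \<le> real k" using real_arch_simple by blast
    ultimately show "x \<in> (\<Union>k. ?S k)" by (auto simp: abs_le_iff intro!: exI[of _ k])
  qed
  moreover have "(SUP k. emeasure \<nu> (?S k)) = emeasure \<nu> (\<Union>k. ?S k)"
  proof (rule SUP_emeasure_incseq)
    have "?S k \<in> sets \<nu>" for k unfolding sets using S by (rule sets.Int) simp
    then show "range ?S \<subseteq> sets \<nu>" by blast
    show "incseq ?S"
    proof (rule incseq_SucI)
      show "?S k \<subseteq> ?S (Suc k)" for k by (rule Int_mono[OF subset_refl]) simp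
    qed
  qed
  moreover have "(SUP k. emeasure \<nu> (?S k)) \<le> ennreal C * emeasure lborel S"
  proof (rule SUP_least)
    fix k
    have "emeasure \<nu> (?S k) \<le> ennreal C * emeasure lborel (?S k)"
      by (rule emeasure_le_lborel_bounded[OF sets C bound]) (use S in auto)
    also have "\<dots> \<le> ennreal C * emeasure lborel S"
      by (intro mult_left_mono emeasure_mono) (use S in auto)
    finally show "emeasure \<nu> (?S k) \<le> ennreal C * emeasure lborel S" .
  qed
  ultimately show ?thesis by simp
qed

text \<open>The Radon-Nikodym derivative exceeds \<open>C\<close> only on a null set, and cutting it
  off at \<open>C\<close> makes the bound hold at every point.\<close>

lemma bounded_density_exists:
  fixes \<nu> :: "real measure"
  assumes sets: "sets \<nu> = sets borel" and C: "0 \<le> C"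
    and le: "\<And>S. S \<in> sets borel \<Longrightarrow> emeasure \<nu> S \<le> ennreal C * emeasure lborel S"
  obtains v where "v \<in> borel_measurable borel" "\<And>x. 0 \<le> v x" "\<And>x. v x \<le> C"
    "\<nu> = density lborel (\<lambda>x. ennreal (v x))"
proof -
  have ac: "absolutely_continuous lborel \<nu>"
    unfolding absolutely_continuous_def
  proof
    fix N :: "real set" assume N: "N \<in> null_sets lborel"
    then have "N \<in> sets borel" "emeasure lborel N = 0" by (auto dest: null_setsD1)
    then have "emeasure \<nu> N = 0" using le[of N] by simp
    then show "N \<in> null_sets \<nu>"
      using \<open>N \<in> sets borel\<close> sets by (intro null_setsI) auto
  qed
  define f where "f = RN_deriv lborel \<nu>"
  have f[measurable]: "f \<in> borel_measurable borel" by (simp add: f_def)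
  have dens: "density lborel f = \<nu>"
    unfolding f_def by (rule sigma_finite_measure.density_RN_deriv[OF lborel.sigma_finite_measure_axioms ac]) (simp add: sets)
  \<comment> \<open>Inside \<open>{- real k..real k}\<close> the superlevel set \<open>?N\<close>
    has finite measure \<open>r\<close>, so \<open>?c * r \<le> C * r\<close> forces
    \<open>r = 0\<close>. The index \<open>k\<close> fixes both the radius and the excess over
    \<open>C\<close>, leaving one countable family of null sets.\<close>
  have "AE x in lborel. \<not> (x \<in> {- real k..real k} \<and> ennreal (C + 1 / real (Suc k)) \<le> f x)" for k :: nat
  proof -
    let ?c = "C + 1 / real (Suc k)"
    let ?N = "{x. x \<in> {- real k..real k} \<and> ennreal ?c \<le> f x}"
    have N: "?N \<in> sets borel" by measurable
    have fin: "emeasure lborel ?N < \<infinity>"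
    proof -
      have "emeasure lborel ?N \<le> emeasure lborel {- real k..real k}"
        by (rule emeasure_mono) auto
      also have "\<dots> < \<infinity>" by simp
      finally show ?thesis .
    qed
    have "ennreal ?c * emeasure lborel ?N = (\<integral>\<^sup>+x. ennreal ?c * indicator ?N x \<partial>lborel)"
      using N by (simp add: nn_integral_cmult_indicator)
    also have "\<dots> \<le> (\<integral>\<^sup>+x. f x * indicator ?N x \<partial>lborel)"
      by (rule nn_integral_mono) (auto simp: indicator_def)
    also have "\<dots> = emeasure \<nu> ?N"
      using N by (subst dens[symmetric], subst emeasure_density) auto
    also have "\<dots> \<le> ennreal C * emeasure lborel ?N" by (rule le[OF N])
    finally have *: "ennreal ?c * emeasure lborel ?N \<le> ennreal C * emeasure lborel ?N" .
    obtain r where r: "emeasure lborel ?N = ennreal r" "0 \<le> r"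
      using fin by (cases "emeasure lborel ?N") auto
    have "?c * r \<le> C * r"
    proof -
      have "ennreal (?c * r) \<le> ennreal (C * r)"
        using * r C ennreal_mult[of ?c r] ennreal_mult[of C r] by simp
      then show ?thesis using r C by (simp add: ennreal_le_iff)
    qed
    then have "r / real (Suc k) \<le> 0" by (simp add: algebra_simps)
    then have "r = 0" using r(2) by (simp add: divide_le_0_iff)
    then have "?N \<in> null_sets lborel" using r N by (auto intro!: null_setsI)
    from AE_not_in[OF this] show ?thesis by simp
  qed
  then have "AE x in lborel. \<forall>k::nat. \<not> (x \<in> {- real k..real k} \<and> ennreal (C + 1 / real (Suc k)) \<le> f x)"
    by (simp add: AE_all_countable)
  then have AE: "AE x in lborel. f x \<le> ennreal C"
  proof eventually_elim
    case (elim x)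
    show ?case
    proof (rule ccontr)
      assume "\<not> f x \<le> ennreal C"
      then have gt: "ennreal C < f x" by simp
      obtain c where c: "ennreal C < ennreal c" "ennreal c \<le> f x"
      proof (cases "f x")
        case (real r) with gt that[of r] show ?thesis by simp
      next
        case top with that[of "C + 1"] C show ?thesis by (simp add: ennreal_less_iff)
      qed
      then have "C < c" using C by (simp add: ennreal_less_iff)
      then obtain m where m: "1 / real (Suc m) < c - C"
        using reals_Archimedean[of "c - C"] by (auto simp: inverse_eq_divide)
      obtain l :: nat where l: "\<bar>x\<bar> \<le> real l" using real_arch_simple by blast
      let ?k = "max l m"
      have "x \<in> {- real ?k..real ?k}" using l by auto
      moreover have "1 / real (Suc ?k) \<le> 1 / real (Suc m)" by (simp add: frac_le)
      then have "ennreal (C + 1 / real (Suc ?k)) \<le> ennreal c" using m by (intro ennreal_leI) linarith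
      then have "ennreal (C + 1 / real (Suc ?k)) \<le> f x" using c(2) by (rule order_trans)
      ultimately show False using elim by blast
    qed
  qed
  define v where "v x = enn2real (min (f x) (ennreal C))" for x
  have v_eq: "ennreal (v x) = min (f x) (ennreal C)" for x
    unfolding v_def by (rule ennreal_enn2real) (simp add: min_less_iff_disj)
  show ?thesis
  proof
    show "v \<in> borel_measurable borel" unfolding v_def by measurable
    show "0 \<le> v x" for x by (simp add: v_def)
    show "v x \<le> C" for x
    proof -
      have "ennreal (v x) \<le> ennreal C" by (simp add: v_eq)
      then show ?thesis using C by (simp add: ennreal_le_iff)
    qed
    show "\<nu> = density lborel (\<lambda>x. ennreal (v x))"
      unfolding dens[symmetric] v_eq
      by (rule density_cong) (use AE in \<open>auto simp: min_def\<close>)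
  qed
qed

subsection \<open>The Euler scheme\<close>

text \<open>The start \<open>x + w 0\<close> agrees with the integral equation at time 0; after that
  the noise \<open>w\<close> enters through its increments alone.\<close>

primrec euler :: "(real \<Rightarrow> real \<Rightarrow> real) \<Rightarrow> real \<Rightarrow> (real \<Rightarrow> real) \<Rightarrow> real \<Rightarrow> nat \<Rightarrow> real" where
  "euler g h w x 0 = x + w 0"
| "euler g h w x (Suc k) =
     euler g h w x k + h * g (real k * h) (euler g h w x k) + (w (real (Suc k) * h) - w (real k * h))"

text \<open>The noise increments cancel in the difference of two runs. One drift step alters a
  distance by at most the fraction \<open>h * L\<close> of it, so at least the fraction
  \<open>1 - h * L\<close> remains.\<close>

lemma euler_expansive:
  assumes h: "0 \<le> h" "h * L \<le> 1"
    and lip: "\<And>k y y'. k < n \<Longrightarrow> \<bar>g (real k * h) y - g (real k * h) y'\<bar> \<le> L * \<bar>y - y'\<bar>"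
  shows "(1 - h * L) ^ n * \<bar>x - x'\<bar> \<le> \<bar>euler g h w x n - euler g h w x' n\<bar>"
  using lip
proof (induction n)
  case (Suc n)
  let ?y = "euler g h w x n" and ?y' = "euler g h w x' n"
  have "(1 - h * L) ^ Suc n * \<bar>x - x'\<bar> = (1 - h * L) * ((1 - h * L) ^ n * \<bar>x - x'\<bar>)" by simp
  also have "\<dots> \<le> (1 - h * L) * \<bar>?y - ?y'\<bar>"
    using Suc h by (intro mult_left_mono Suc.IH) auto
  also have "\<dots> \<le> \<bar>?y - ?y'\<bar> - h * \<bar>g (real n * h) ?y - g (real n * h) ?y'\<bar>"
    using mult_left_mono[OF Suc.prems[of n ?y ?y'] h(1)] by (simp add: algebra_simps)
  also have "\<dots> = \<bar>?y - ?y'\<bar> - \<bar>h * (g (real n * h) ?y - g (real n * h) ?y')\<bar>"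
    using h by (simp add: abs_mult)
  also have "\<dots> \<le> \<bar>euler g h w x (Suc n) - euler g h w x' (Suc n)\<bar>"
    by (simp add: algebra_simps)
  finally show ?case .
qed simp

text \<open>The noise cancels in the error as well. The drift \<open>d\<close> along the solution is
  uniformly continuous, which makes the local error at most \<open>e * h\<close> per step, and a
  discrete Gronwall estimate accumulates these errors.\<close>

lemma euler_tendsto:
  assumes t: "0 < t" and L: "0 \<le> L"
    and lip: "\<And>s s' y y'. s \<in> {0..t} \<Longrightarrow> s' \<in> {0..t} \<Longrightarrow> \<bar>g s y - g s' y'\<bar> \<le> L * (\<bar>s - s'\<bar> + \<bar>y - y'\<bar>)"
    and cont: "continuous_on {0..t} Y"
    and eq: "\<And>s. s \<in> {0..t} \<Longrightarrow> Y s = x + integral {0..s} (\<lambda>u. g u (Y u)) + w s"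
  shows "(\<lambda>n. euler g (t / real n) w x n) \<longlonglongrightarrow> Y t"
proof (rule LIMSEQ_I)
  fix r :: real assume r: "0 < r"
  define d where "d u = g u (Y u)" for u
  have "continuous_on {0..t} d"
    unfolding continuous_on_iff
  proof safe
    fix s e :: real assume s: "s \<in> {0..t}" and e: "0 < e"
    \<comment> \<open>Chosen so that \<open>(L + 1) * (e' + e') = e\<close>; the summand 1 keeps the
      quotient meaningful for \<open>L = 0\<close>.\<close>
    define e' where "e' = e / (L + 1) / 2"
    have e': "0 < e'" using e L by (simp add: e'_def)
    obtain \<delta> where \<delta>: "\<delta> > 0" "\<And>s'. s' \<in> {0..t} \<Longrightarrow> dist s' s < \<delta> \<Longrightarrow> dist (Y s') (Y s) < e'"
      using cont s e' unfolding continuous_on_iff by meson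
    have "dist (d s') (d s) < e" if "s' \<in> {0..t}" "dist s' s < min \<delta> e'" for s'
    proof -
      have "\<bar>d s' - d s\<bar> \<le> L * (\<bar>s' - s\<bar> + \<bar>Y s' - Y s\<bar>)" unfolding d_def using that s by (intro lip) auto
      also have "\<dots> \<le> L * (e' + e')"
        using that \<delta>(2)[of s'] L by (intro mult_left_mono add_mono) (auto simp: dist_real_def)
      also have "\<dots> < (L + 1) * (e' + e')" using e' by (simp add: algebra_simps)
      also have "\<dots> = e" unfolding e'_def field_sum_of_halves using L by simp
      finally show ?thesis by (simp add: dist_real_def)
    qed
    then show "\<exists>\<delta>>0. \<forall>s'\<in>{0..t}. dist s' s < \<delta> \<longrightarrow> dist (d s') (d s) < e"
      using \<delta>(1) e' by (intro exI[of _ "min \<delta> e'"]) auto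
  qed
  then have d_int: "d integrable_on {0..t}" and "uniformly_continuous_on {0..t} d"
    by (auto intro: integrable_continuous_interval compact_uniformly_continuous)
  \<comment> \<open>With this \<open>e\<close> the final error bound
    \<open>t * e * exp (t * L)\<close> equals \<open>r / 2\<close>.\<close>
  moreover define e where "e = r / (2 * t * exp (t * L))"
  have e: "0 < e" using r t by (simp add: e_def)
  ultimately obtain \<delta> where \<delta>: "\<delta> > 0"
    "\<And>u s. u \<in> {0..t} \<Longrightarrow> s \<in> {0..t} \<Longrightarrow> dist s u < \<delta> \<Longrightarrow> dist (d s) (d u) < e"
    unfolding uniformly_continuous_on_def by meson
  have d_int': "d integrable_on {u..v}" if "0 \<le> u" "v \<le> t" for u v
    by (rule integrable_on_subinterval[OF d_int]) (use that in auto)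
  obtain N :: nat where N: "t / \<delta> < real N" using reals_Archimedean2 by blast
  have "norm (euler g (t / real n) w x n - Y t) < r" if n: "N \<le> n" for n
  proof -
    define h where "h = t / real n"
    have n0: "0 < real n" using N n t \<delta>(1) by (smt (verit) divide_pos_pos of_nat_le_iff)
    have h: "0 < h" "real n * h = t" using n0 t by (auto simp: h_def)
    have "t / \<delta> < real n" using N n by (smt (verit) of_nat_le_iff)
    then have h\<delta>: "h < \<delta>" using n0 \<delta>(1) by (simp add: h_def field_simps)
    \<comment> \<open>Each of the \<open>k\<close> steps contributes a local error
      \<open>h * e\<close>, and no contribution is amplified by more than
      \<open>(1 + h * L) ^ k\<close>.\<close>
    have err: "\<bar>euler g h w x k - Y (real k * h)\<bar> \<le> real k * h * e * (1 + h * L) ^ k" if "k \<le> n" for k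
      using that
    proof (induction k)
      case 0
      then show ?case using eq[of 0] t by simp
    next
      case (Suc k)
      let ?s = "real k * h" and ?s' = "real (Suc k) * h" and ?y = "euler g h w x k"
      have s: "0 \<le> ?s" "?s \<le> ?s'" "?s' - ?s = h" using h by (auto simp: algebra_simps)
      have s': "?s' \<le> t"
        unfolding h(2)[symmetric] by (rule mult_right_mono) (use Suc h in auto)
      have di: "d integrable_on {0..?s'}" "d integrable_on {?s..?s'}"
        using d_int' s(1) s' by blast+
      have "integral {0..?s} d + integral {?s..?s'} d = integral {0..?s'} d"
        by (rule Henstock_Kurzweil_Integration.integral_combine) (use s di in auto)
      moreover have "Y ?s = x + integral {0..?s} d + w ?s" "Y ?s' = x + integral {0..?s'} d + w ?s'"
        unfolding d_def using s s' by (intro eq; simp)+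
      ultimately have Y: "Y ?s' = Y ?s + integral {?s..?s'} d + (w ?s' - w ?s)" by simp
      have "integral {?s..?s'} (\<lambda>u. d u - d ?s) = integral {?s..?s'} d - h * d ?s"
      proof -
        have "integral {?s..?s'} (\<lambda>u. d u - d ?s)
            = integral {?s..?s'} d - integral {?s..?s'} (\<lambda>u. d ?s)"
          by (rule Henstock_Kurzweil_Integration.integral_diff[OF di(2) integrable_const_ivl])
        also have "integral {?s..?s'} (\<lambda>u. d ?s) = h * d ?s"
          unfolding integral_const_real using s(2,3) by (metis content_real real_scaleR_def)
        finally show ?thesis .
      qed
      moreover have "\<bar>integral {?s..?s'} (\<lambda>u. d u - d ?s)\<bar> \<le> e * (?s' - ?s)"
      proof (rule integral_abs_le[OF s(2)])
        fix u assume u: "u \<in> {?s..?s'}"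
        have "dist u ?s < \<delta>" using u s h\<delta> by (auto simp: dist_real_def)
        moreover have "u \<in> {0..t}" "?s \<in> {0..t}"
          using u s(1,2) s' by (meson atLeastAtMost_iff order_trans)+
        ultimately show "\<bar>d u - d ?s\<bar> \<le> e"
          using \<delta>(2)[of ?s u] by (simp add: dist_real_def less_imp_le)
      qed
      ultimately have 1: "\<bar>integral {?s..?s'} d - h * d ?s\<bar> \<le> e * h" using s(3) by simp
      have "\<bar>g ?s ?y - d ?s\<bar> \<le> L * \<bar>?y - Y ?s\<bar>"
        unfolding d_def using lip[of ?s ?s ?y "Y ?s"] s s' by auto
      then have "\<bar>h * (g ?s ?y - d ?s)\<bar> \<le> h * (L * \<bar>?y - Y ?s\<bar>)"
        using h by (simp add: abs_mult)
      then have "\<bar>euler g h w x (Suc k) - Y ?s'\<bar> \<le> \<bar>?y - Y ?s\<bar> + h * (L * \<bar>?y - Y ?s\<bar>) + e * h"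
        using 1 unfolding Y by (simp add: right_diff_distrib)
      also have "\<dots> = (1 + h * L) * \<bar>?y - Y ?s\<bar> + h * e" by (simp add: algebra_simps)
      also have "\<dots> \<le> (1 + h * L) * (real k * h * e * (1 + h * L) ^ k) + h * e * (1 + h * L) ^ Suc k"
      proof (rule add_mono)
        show "(1 + h * L) * \<bar>?y - Y ?s\<bar> \<le> (1 + h * L) * (real k * h * e * (1 + h * L) ^ k)"
          using Suc h L by (intro mult_left_mono) auto
        have "1 \<le> (1 + h * L) ^ Suc k" using h L by (intro one_le_power) auto
        then show "h * e \<le> h * e * (1 + h * L) ^ Suc k" using h e by simp
      qed
      also have "\<dots> = real (Suc k) * h * e * (1 + h * L) ^ Suc k" by (simp add: algebra_simps)
      finally show ?case .
    qed
    have "(1 + h * L) ^ n \<le> exp (h * L) ^ n" using h L by (intro power_mono) auto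
    also have "\<dots> = exp (t * L)"
      using h by (simp add: exp_of_nat_mult[symmetric] mult.assoc[symmetric])
    finally have "t * e * (1 + h * L) ^ n \<le> t * e * exp (t * L)"
      using t e by (intro mult_left_mono) auto
    also have "\<dots> < r" using t r by (simp add: e_def)
    finally show ?thesis using err[of n] h by (simp add: h_def[symmetric])
  qed
  then show "\<exists>N. \<forall>n\<ge>N. norm (euler g (t / real n) w x n - Y t) < r" by blast
qed

text \<open>The scheme reads only finitely many coordinates of the path, hence is measurable for the
  product sigma-algebra. Joint measurability in initial value and path is what Fubini requires in
  \<open>euler_prob_interval\<close>.\<close>

lemma euler_measurable:
  assumes "\<And>k. k < n \<Longrightarrow> continuous_on UNIV (g (real k * h))"
  shows "(\<lambda>p. euler g h (\<lambda>s. c * snd p s) (fst p) n)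
           \<in> borel_measurable (borel \<Otimes>\<^sub>M Pi\<^sub>M UNIV (\<lambda>_. borel))"
  using assms
proof (induction n)
  case 0
  show ?case by simp measurable
next
  case (Suc n)
  have [measurable]: "g (real n * h) \<in> borel_measurable borel"
    using Suc.prems by (intro borel_measurable_continuous_onI) auto
  have [measurable]: "(\<lambda>p. euler g h (\<lambda>s. c * snd p s) (fst p) n)
           \<in> borel_measurable (borel \<Otimes>\<^sub>M Pi\<^sub>M UNIV (\<lambda>_. borel))"
    using Suc by auto
  show ?case by simp measurable
qed

lemma euler_random_variable:
  assumes "X0 \<in> borel_measurable M" "(\<lambda>\<omega> s. W s \<omega>) \<in> measurable M (Pi\<^sub>M UNIV (\<lambda>_. borel))"
    and "\<And>k. k < n \<Longrightarrow> continuous_on UNIV (g (real k * h))"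
  shows "(\<lambda>\<omega>. euler g h (\<lambda>s. c * W s \<omega>) (X0 \<omega>) n) \<in> borel_measurable M"
proof -
  have "(\<lambda>p. euler g h (\<lambda>s. c * snd p s) (fst p) n) \<in> borel_measurable (borel \<Otimes>\<^sub>M Pi\<^sub>M UNIV (\<lambda>_. borel))"
    by (rule euler_measurable) (rule assms(3))
  from measurable_compose[OF measurable_Pair[OF assms(1,2)] this] show ?thesis by simp
qed

lemma continuous_on_abs_lipschitz:
  fixes f :: "real \<Rightarrow> real"
  assumes "\<And>x y. \<bar>f x - f y\<bar> \<le> L * \<bar>x - y\<bar>"
  shows "continuous_on UNIV f"
proof (rule lipschitz_on_continuous_on, rule lipschitz_onI)
  show "dist (f x) (f y) \<le> \<bar>L\<bar> * dist x y" for x y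
    using assms[of x y] mult_right_mono[OF abs_ge_self[of L], of "\<bar>x - y\<bar>"]
    by (simp add: dist_real_def)
qed simp

text \<open>The product formula on rectangles determines the joint law. It is stated for two
  arbitrary target spaces because it is applied to a real variable and a path-valued one.\<close>

lemma (in prob_space) distr_pair_indep:
  assumes X[measurable]: "X \<in> measurable M S" and Y[measurable]: "Y \<in> measurable M T"
    and indep: "\<And>A B. A \<in> sets S \<Longrightarrow> B \<in> sets T \<Longrightarrow>
      prob ((X -` A \<inter> space M) \<inter> (Y -` B \<inter> space M)) = prob (X -` A \<inter> space M) * prob (Y -` B \<inter> space M)"
  shows "distr M S X \<Otimes>\<^sub>M distr M T Y = distr M (S \<Otimes>\<^sub>M T) (\<lambda>\<omega>. (X \<omega>, Y \<omega>))"
proof -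
  interpret X: prob_space "distr M S X" by (rule prob_space_distr[OF X])
  interpret Y: prob_space "distr M T Y" by (rule prob_space_distr[OF Y])
  show ?thesis
  proof (rule pair_measure_eqI)
    show "sigma_finite_measure (distr M S X)" "sigma_finite_measure (distr M T Y)" ..
  next
    fix A B assume A: "A \<in> sets (distr M S X)" and B: "B \<in> sets (distr M T Y)"
    have "emeasure (distr M (S \<Otimes>\<^sub>M T) (\<lambda>\<omega>. (X \<omega>, Y \<omega>))) (A \<times> B)
        = emeasure M ((X -` A \<inter> space M) \<inter> (Y -` B \<inter> space M))"
      using A B by (subst emeasure_distr) (auto intro!: arg_cong[where f="emeasure M"])
    also have "\<dots> = emeasure M (X -` A \<inter> space M) * emeasure M (Y -` B \<inter> space M)"
      using indep[of A B] A B by (simp add: emeasure_eq_measure ennreal_mult'')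
    finally show "emeasure (distr M S X) A * emeasure (distr M T Y) B
        = emeasure (distr M (S \<Otimes>\<^sub>M T) (\<lambda>\<omega>. (X \<omega>, Y \<omega>))) (A \<times> B)"
      using A B by (simp add: emeasure_distr)
  qed simp
qed

text \<open>For a frozen path of \<open>W\<close> the scheme is an expansive map of the initial value, so the initial
  values leading into \<open>{a<..<b}\<close> have diameter at most \<open>(b - a) / (1 - h * L) ^ n\<close>.\<close>
lemma (in prob_space) euler_prob_interval:
  fixes X0 :: "'a \<Rightarrow> real" and W :: "real \<Rightarrow> 'a \<Rightarrow> real"
  assumes rv: "X0 \<in> borel_measurable M" "(\<lambda>\<omega> s. W s \<omega>) \<in> measurable M (Pi\<^sub>M UNIV (\<lambda>_. borel))"
    and indep: "\<And>A B. A \<in> sets borel \<Longrightarrow> B \<in> sets (Pi\<^sub>M UNIV (\<lambda>_. borel)) \<Longrightarrow>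
      prob ((X0 -` A \<inter> space M) \<inter> ((\<lambda>\<omega> s. W s \<omega>) -` B \<inter> space M))
        = prob (X0 -` A \<inter> space M) * prob ((\<lambda>\<omega> s. W s \<omega>) -` B \<inter> space M)"
    and X0: "distributed M lborel X0 (\<lambda>x. ennreal (\<rho> x))" and R: "\<And>x. \<rho> x \<le> R"
    and h: "0 \<le> h" "h * L < 1"
    and lip: "\<And>k y y'. k < n \<Longrightarrow> \<bar>g (real k * h) y - g (real k * h) y'\<bar> \<le> L * \<bar>y - y'\<bar>"
    and ab: "a < b"
  shows "emeasure M {\<omega> \<in> space M. euler g h (\<lambda>s. c * W s \<omega>) (X0 \<omega>) n \<in> {a<..<b}}
           \<le> ennreal R * ennreal (2 * (b - a) / (1 - h * L) ^ n)"
proof -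
  let ?P = "Pi\<^sub>M UNIV (\<lambda>_::real. borel :: real measure)"
  let ?F = "\<lambda>p. euler g h (\<lambda>s. c * snd p s) (fst p) n"
  let ?D = "distr M borel X0" and ?E = "distr M ?P (\<lambda>\<omega> s. W s \<omega>)"
  define d where "d = (b - a) / (1 - h * L) ^ n"
  have pos: "0 < (1 - h * L) ^ n" using h by simp
  have d0: "0 < d" using pos ab by (simp add: d_def)
  have pair: "?D \<Otimes>\<^sub>M ?E = distr M (borel \<Otimes>\<^sub>M ?P) (\<lambda>\<omega>. (X0 \<omega>, \<lambda>s. W s \<omega>))"
    by (rule distr_pair_indep[OF rv indep])
  interpret D: prob_space ?D by (rule prob_space_distr[OF rv(1)])
  interpret E: prob_space ?E by (rule prob_space_distr[OF rv(2)])
  interpret DE: pair_sigma_finite ?D ?E ..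
  have "continuous_on UNIV (g (real k * h))" if "k < n" for k
    by (rule continuous_on_abs_lipschitz) (rule lip[OF that])
  then have F: "?F \<in> borel_measurable (borel \<Otimes>\<^sub>M ?P)" by (intro euler_measurable)
  define S where "S = ?F -` {a<..<b} \<inter> space (borel \<Otimes>\<^sub>M ?P)"
  have S: "S \<in> sets (borel \<Otimes>\<^sub>M ?P)" unfolding S_def by (rule measurable_sets[OF F]) simp
  have "emeasure M {\<omega> \<in> space M. euler g h (\<lambda>s. c * W s \<omega>) (X0 \<omega>) n \<in> {a<..<b}}
      = emeasure (distr M (borel \<Otimes>\<^sub>M ?P) (\<lambda>\<omega>. (X0 \<omega>, \<lambda>s. W s \<omega>))) S"
    using rv S by (subst emeasure_distr)
      (auto intro!: arg_cong[where f="emeasure M"] simp: S_def space_pair_measure space_PiM)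
  also have "\<dots> = emeasure (?D \<Otimes>\<^sub>M ?E) S" by (simp add: pair)
  \<comment> \<open>Fubini: the path \<open>w\<close> is frozen and the initial value integrated
    first.\<close>
  also have "\<dots> = (\<integral>\<^sup>+w. emeasure ?D ((\<lambda>x. (x, w)) -` S) \<partial>?E)"
    by (rule DE.emeasure_pair_measure_alt2) (use S in simp)
  also have "\<dots> \<le> (\<integral>\<^sup>+w. ennreal R * ennreal (2 * d) \<partial>?E)"
  proof (rule nn_integral_mono)
    fix w
    let ?A = "(\<lambda>x. (x, w)) -` S"
    \<comment> \<open>An arbitrary member \<open>x1\<close> of the set serves as centre, so the
      enclosing interval has length \<open>2 * d\<close>; this is the factor 2 in the
      statement.\<close>
    have sub: "?A \<subseteq> {x1 - d..x1 + d}" if x1: "x1 \<in> ?A" for x1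
    proof
      fix x assume x: "x \<in> ?A"
      have "(1 - h * L) ^ n * \<bar>x - x1\<bar> \<le> \<bar>?F (x, w) - ?F (x1, w)\<bar>"
        unfolding fst_conv snd_conv by (rule euler_expansive) (use h lip in auto)
      also have "\<dots> \<le> b - a" using x x1 by (auto simp: S_def)
      finally have "\<bar>x - x1\<bar> \<le> d" using pos by (simp add: d_def field_simps)
      then show "x \<in> {x1 - d..x1 + d}" by auto
    qed
    obtain x1 where x1: "?A \<subseteq> {x1 - d..x1 + d}" using sub by (cases "?A = {}") auto
    have "emeasure ?D ?A \<le> emeasure ?D {x1 - d..x1 + d}"
      by (rule emeasure_mono[OF x1]) simp
    also have "\<dots> = emeasure (distr M lborel X0) {x1 - d..x1 + d}"
      by (intro arg_cong2[where f=emeasure] distr_cong) auto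
    also have "\<dots> = (\<integral>\<^sup>+x. ennreal (\<rho> x) * indicator {x1 - d..x1 + d} x \<partial>lborel)"
      using X0 unfolding distributed_def by (simp add: emeasure_density)
    also have "\<dots> \<le> (\<integral>\<^sup>+x. ennreal R * indicator {x1 - d..x1 + d} x \<partial>lborel)"
      using R by (intro nn_integral_mono mult_right_mono ennreal_leI) auto
    also have "\<dots> = ennreal R * ennreal (2 * d)"
      using d0 by (simp add: nn_integral_cmult_indicator)
    finally show "emeasure ?D ?A \<le> ennreal R * ennreal (2 * d)" .
  qed
  also have "\<dots> = ennreal R * ennreal (2 * d)" using E.emeasure_space_1 by simp
  finally show ?thesis by (simp add: d_def)
qed

subsection \<open>The killed law and the drift\<close>

lemma sets_killed_law: "sets (killed_law M X t) = sets borel"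
  using sets.sigma_sets_eq[of "borel :: real measure"] by (simp add: killed_law_def sets_measure_of)

text \<open>The set function given to \<open>measure_of\<close> takes effect only if it is a
  measure. Recognizing it as the image of \<open>M\<close> restricted to the survival event settles
  countable additivity and provides the change of variables.\<close>

lemma killed_law_eq_distr:
  assumes X: "\<forall>S\<in>sets borel. {\<omega> \<in> space M. X t \<omega> \<in> Some ` S} \<in> sets M"
  defines "E \<equiv> {\<omega> \<in> space M. X t \<omega> \<noteq> None}"
  shows "E \<in> sets M" "(\<lambda>\<omega>. the (X t \<omega>)) \<in> borel_measurable (restrict_space M E)"
    "killed_law M X t = distr (restrict_space M E) borel (\<lambda>\<omega>. the (X t \<omega>))"
proof -
  have "E = {\<omega> \<in> space M. X t \<omega> \<in> Some ` UNIV}" by (auto simp: E_def image_iff)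
  then show E: "E \<in> sets M" using X by simp
  have vim: "(\<lambda>\<omega>. the (X t \<omega>)) -` S \<inter> space (restrict_space M E) = {\<omega> \<in> space M. X t \<omega> \<in> Some ` S}" for S
    by (auto simp: E_def space_restrict_space image_iff)
  show meas: "(\<lambda>\<omega>. the (X t \<omega>)) \<in> borel_measurable (restrict_space M E)"
  proof (rule measurableI)
    fix S :: "real set" assume "S \<in> sets borel"
    then show "(\<lambda>\<omega>. the (X t \<omega>)) -` S \<inter> space (restrict_space M E) \<in> sets (restrict_space M E)"
      unfolding vim using X E by (subst sets_restrict_space_iff) (auto simp: E_def)
  qed simp
  show "killed_law M X t = distr (restrict_space M E) borel (\<lambda>\<omega>. the (X t \<omega>))"
    unfolding killed_law_def distr_def space_borel
  proof (rule measure_of_eq)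
    fix S :: "real set" assume "S \<in> sigma_sets UNIV (sets borel)"
    then have "S \<in> sets borel" using sets.sigma_sets_eq[of "borel :: real measure"] by simp
    then show "emeasure M {\<omega> \<in> space M. X t \<omega> \<in> Some ` S}
        = emeasure (restrict_space M E) ((\<lambda>\<omega>. the (X t \<omega>)) -` S \<inter> space (restrict_space M E))"
      unfolding vim by (intro emeasure_restrict_space[symmetric]) (use E in \<open>auto simp: E_def\<close>)
  qed simp
qed

lemma emeasure_killed_law:
  assumes X: "\<forall>S\<in>sets borel. {\<omega> \<in> space M. X t \<omega> \<in> Some ` S} \<in> sets M"
    and S: "S \<in> sets borel"
  shows "emeasure (killed_law M X t) S = emeasure M {\<omega> \<in> space M. X t \<omega> \<in> Some ` S}"
proof -
  let ?E = "{\<omega> \<in> space M. X t \<omega> \<noteq> None}"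
  note E = killed_law_eq_distr[where X=X and t=t and M=M, OF X]
  have "emeasure (killed_law M X t) S
      = emeasure (restrict_space M ?E) ((\<lambda>\<omega>. the (X t \<omega>)) -` S \<inter> space (restrict_space M ?E))"
    using E S by (simp add: emeasure_distr)
  also have "(\<lambda>\<omega>. the (X t \<omega>)) -` S \<inter> space (restrict_space M ?E) = {\<omega> \<in> space M. X t \<omega> \<in> Some ` S}"
    by (auto simp: space_restrict_space image_iff)
  also have "emeasure (restrict_space M ?E) \<dots> = emeasure M \<dots>"
    by (rule emeasure_restrict_space) (use E(1) in auto)
  finally show ?thesis .
qed

text \<open>The convolution becomes an expectation over the fixed space \<open>M\<close>, with the
  cemetery contributing 0, so that regularity in time can be read off from the paths.\<close>

lemma conv_meas_killed_law:
  assumes X: "\<forall>S\<in>sets borel. {\<omega> \<in> space M. X t \<omega> \<in> Some ` S} \<in> sets M"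
    and k: "k \<in> borel_measurable borel"
  shows "(\<lambda>\<omega>. ext_cem (\<lambda>y. k (x - y)) (X t \<omega>)) \<in> borel_measurable M"
    "conv_meas k (killed_law M X t) x = (\<integral>\<omega>. ext_cem (\<lambda>y. k (x - y)) (X t \<omega>) \<partial>M)"
proof -
  let ?E = "{\<omega> \<in> space M. X t \<omega> \<noteq> None}"
  note E = killed_law_eq_distr[where X=X and t=t and M=M, OF X]
  have [measurable]: "(\<lambda>y. k (x - y)) \<in> borel_measurable borel"
    using k by measurable
  have kX: "(\<lambda>\<omega>. k (x - the (X t \<omega>))) \<in> borel_measurable (restrict_space M ?E)"
    using measurable_compose[OF E(2), of "\<lambda>y. k (x - y)"] by simp
  have eq: "indicator ?E \<omega> *\<^sub>R k (x - the (X t \<omega>)) = ext_cem (\<lambda>y. k (x - y)) (X t \<omega>)" if "\<omega> \<in> space M" for \<omega>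
    using that by (cases "X t \<omega>") (auto simp: ext_cem_def)
  have "(\<lambda>\<omega>. indicator ?E \<omega> *\<^sub>R k (x - the (X t \<omega>))) \<in> borel_measurable M"
    using kX E(1) by (subst (asm) borel_measurable_restrict_space_iff) auto
  then show "(\<lambda>\<omega>. ext_cem (\<lambda>y. k (x - y)) (X t \<omega>)) \<in> borel_measurable M"
    by (subst measurable_cong[OF eq[symmetric]])
  have "conv_meas k (killed_law M X t) x = (\<integral>\<omega>. k (x - the (X t \<omega>)) \<partial>restrict_space M ?E)"
    unfolding conv_meas_def E(3) by (rule integral_distr[OF E(2)]) measurable
  also have "\<dots> = (\<integral>\<omega>. indicator ?E \<omega> *\<^sub>R k (x - the (X t \<omega>)) \<partial>M)"
    by (rule integral_restrict_space) (use E(1) in auto)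
  also have "\<dots> = (\<integral>\<omega>. ext_cem (\<lambda>y. k (x - y)) (X t \<omega>) \<partial>M)"
    by (rule Bochner_Integration.integral_cong[OF refl eq])
  finally show "conv_meas k (killed_law M X t) x = (\<integral>\<omega>. ext_cem (\<lambda>y. k (x - y)) (X t \<omega>) \<partial>M)" .
qed

lemma (in prob_space) conv_meas_killed_law_bounds:
  assumes X: "\<forall>S\<in>sets borel. {\<omega> \<in> space M. X t \<omega> \<in> Some ` S} \<in> events"
    and k: "k \<in> borel_measurable borel" "\<And>x. \<bar>k x\<bar> \<le> B"
  shows "\<bar>conv_meas k (killed_law M X t) x\<bar> \<le> B"
    "(\<And>x. 0 \<le> k x) \<Longrightarrow> 0 \<le> conv_meas k (killed_law M X t) x"
    "(\<And>x y. \<bar>k x - k y\<bar> \<le> L * \<bar>x - y\<bar>) \<Longrightarrow>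
      \<bar>conv_meas k (killed_law M X t) x - conv_meas k (killed_law M X t) y\<bar> \<le> L * \<bar>x - y\<bar>"
proof -
  let ?F = "\<lambda>x \<omega>. ext_cem (\<lambda>y. k (x - y)) (X t \<omega>)"
  note eq = conv_meas_killed_law(2)[where X=X and t=t and M=M, OF X k(1)]
  have B0: "0 \<le> B" using k(2)[of 0] by linarith
  have bdd: "norm (?F x \<omega>) \<le> B" for x \<omega>
    using k(2) B0 by (auto simp: ext_cem_def split: option.split)
  have int: "integrable M (?F x)" for x
    by (rule integrable_const_bound[of _ B]) (use bdd conv_meas_killed_law(1)[where X=X and t=t and M=M, OF X k(1)] in auto)
  have le: "\<bar>expectation f\<bar> \<le> b" if "integrable M f" "\<And>\<omega>. \<bar>f \<omega>\<bar> \<le> b" for f :: "'a \<Rightarrow> real" and b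
  proof -
    have "\<bar>expectation f\<bar> \<le> expectation (\<lambda>\<omega>. \<bar>f \<omega>\<bar>)" by (rule integral_abs_bound)
    also have "\<dots> \<le> expectation (\<lambda>_. b)" by (rule integral_mono) (use that in auto)
    finally show ?thesis by (simp add: prob_space)
  qed
  show "\<bar>conv_meas k (killed_law M X t) x\<bar> \<le> B"
    unfolding eq by (rule le[OF int]) (use bdd in auto)
  show "0 \<le> conv_meas k (killed_law M X t) x" if "\<And>x. 0 \<le> k x"
    unfolding eq by (rule Bochner_Integration.integral_nonneg) (use that in \<open>auto simp: ext_cem_def split: option.split\<close>)
  show "\<bar>conv_meas k (killed_law M X t) x - conv_meas k (killed_law M X t) y\<bar> \<le> L * \<bar>x - y\<bar>"
    if L: "\<And>x y. \<bar>k x - k y\<bar> \<le> L * \<bar>x - y\<bar>"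
  proof -
    have "conv_meas k (killed_law M X t) x - conv_meas k (killed_law M X t) y = expectation (\<lambda>\<omega>. ?F x \<omega> - ?F y \<omega>)"
      unfolding eq by (rule Bochner_Integration.integral_diff[symmetric]) (rule int)+
    moreover have "\<bar>expectation (\<lambda>\<omega>. ?F x \<omega> - ?F y \<omega>)\<bar> \<le> L * \<bar>x - y\<bar>"
    proof (rule le)
      fix \<omega>
      show "\<bar>?F x \<omega> - ?F y \<omega>\<bar> \<le> L * \<bar>x - y\<bar>"
        \<comment> \<open>The first instance covers the cemetery case, where the difference is 0 and
          only \<open>0 \<le> L * \<bar>x - y\<bar>\<close> is at stake.\<close>
        using L[of x y] L[of "x - the (X t \<omega>)" "y - the (X t \<omega>)"]
        by (cases "X t \<omega>") (auto simp: ext_cem_def)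
    qed (use int in auto)
    ultimately show ?thesis by simp
  qed
qed

text \<open>Up to a constant factor the drift is \<open>q a * b\<close> with
  \<open>q = e / den\<close>, and \<open>q\<close> is at most \<open>1 / m\<close>. In a difference
  of two values of \<open>q\<close> the \<open>phi1\<close> terms cancel after cross-multiplication,
  leaving \<open>phi0 * (e a - e a')\<close> over a product of denominators that is at least
  \<open>m\<^sup>2\<close>.\<close>

lemma drift_b_bounds:
  assumes pos: "0 < lam" "0 < c0" "0 < phi0" "0 < m"
    and phi: "\<And>x. x \<in> {0..A} \<Longrightarrow> m \<le> phi0 + phi1 * c0 * exp (- lam * x)"
    and a: "a \<in> {0..A}" and b: "\<bar>b\<bar> \<le> B"
  shows "\<bar>drift_b lam c0 phi0 phi1 a b\<bar> \<le> \<bar>phi1\<bar> * lam * c0 * B / m"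
    and "a' \<in> {0..A} \<Longrightarrow> \<bar>drift_b lam c0 phi0 phi1 a b - drift_b lam c0 phi0 phi1 a' b'\<bar>
      \<le> \<bar>phi1\<bar> * lam * c0 * (phi0 * lam / m\<^sup>2 * B * \<bar>a - a'\<bar> + \<bar>b - b'\<bar> / m)"
proof -
  define e where "e x = exp (- lam * x)" for x
  define den where "den x = phi0 + phi1 * c0 * e x" for x
  define q where "q x = e x / den x" for x
  have drift: "drift_b lam c0 phi0 phi1 x y = - (phi1 * lam * c0) * (q x * y)" for x y
    by (simp add: drift_b_def q_def e_def den_def)
  have den: "m \<le> den x" if "x \<in> {0..A}" for x using phi[OF that] by (simp add: den_def e_def)
  have e01: "0 < e x" "e x \<le> 1" if "x \<in> {0..A}" for x using that pos by (auto simp: e_def)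
  have q0: "0 < q x" "q x \<le> 1 / m" if "x \<in> {0..A}" for x
    using den[OF that] e01[OF that] pos by (auto simp: q_def intro!: frac_le divide_pos_pos)
  have absc: "\<bar>phi1 * lam * c0\<bar> = \<bar>phi1\<bar> * lam * c0" using pos by (simp add: abs_mult)
  have B0: "0 \<le> B" using b by linarith
  have "\<bar>q a * b\<bar> \<le> 1 / m * B"
    unfolding abs_mult using q0[OF a] b pos by (intro mult_mono) auto
  then have "\<bar>phi1\<bar> * lam * c0 * \<bar>q a * b\<bar> \<le> \<bar>phi1\<bar> * lam * c0 * (1 / m * B)"
    using pos by (intro mult_left_mono) auto
  then show "\<bar>drift_b lam c0 phi0 phi1 a b\<bar> \<le> \<bar>phi1\<bar> * lam * c0 * B / m"
    unfolding drift by (simp only: abs_minus_cancel mult_minus_left abs_mult[of "phi1 * lam * c0"] absc) simp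
  assume a': "a' \<in> {0..A}"
  have e_lip: "\<bar>e x - e y\<bar> \<le> lam * \<bar>x - y\<bar>" if "x \<in> {0..A}" "y \<in> {0..A}" for x y
  proof -
    have *: "\<bar>e u - e v\<bar> \<le> lam * \<bar>u - v\<bar>" if "u \<in> {0..A}" "u \<le> v" for u v
    proof -
      have ev: "e v = e u * exp (- lam * (v - u))" by (simp add: e_def exp_add[symmetric] algebra_simps)
      have ex: "1 - lam * (v - u) \<le> exp (- lam * (v - u))" using exp_ge_add_one_self[of "- lam * (v - u)"] by simp
      have le1: "exp (- lam * (v - u)) \<le> 1" using that pos by auto
      have "\<bar>e u - e v\<bar> = e u * (1 - exp (- lam * (v - u)))"
        using e01[OF that(1)] le1 unfolding ev by (simp add: right_diff_distrib abs_of_nonneg)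
      also have "\<dots> \<le> 1 * (lam * (v - u))"
        using e01[OF that(1)] ex le1 by (intro mult_mono) auto
      finally show ?thesis using that by simp
    qed
    show ?thesis using *[of x y] *[of y x] that by (cases "x \<le> y") (auto simp: abs_minus_commute)
  qed
  have q_lip: "\<bar>q a - q a'\<bar> \<le> phi0 * lam / m\<^sup>2 * \<bar>a - a'\<bar>"
  proof -
    have nz: "den a > 0" "den a' > 0" using den[OF a] den[OF a'] pos by auto
    have "q a - q a' = phi0 * (e a - e a') / (den a * den a')"
      using nz by (simp add: q_def field_simps) (simp add: den_def algebra_simps)
    then have "\<bar>q a - q a'\<bar> = phi0 * \<bar>e a - e a'\<bar> / (den a * den a')"
      using nz pos by (simp add: abs_mult abs_divide)
    also have "\<dots> \<le> phi0 * (lam * \<bar>a - a'\<bar>) / (m * m)"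
      using nz pos den[OF a] den[OF a'] e_lip[OF a a'] by (intro frac_le mult_left_mono mult_mono) auto
    finally show ?thesis by (simp add: power2_eq_square)
  qed
  \<comment> \<open>The increment of \<open>q\<close> is paired with \<open>b\<close>, which is
    bounded by \<open>B\<close>, and the increment of \<open>b\<close> with \<open>q a'\<close>,
    which is bounded by \<open>1 / m\<close>.\<close>
  have "\<bar>q a * b - q a' * b'\<bar> = \<bar>(q a - q a') * b + q a' * (b - b')\<bar>" by (simp add: algebra_simps)
  also have "\<dots> \<le> \<bar>q a - q a'\<bar> * \<bar>b\<bar> + \<bar>q a'\<bar> * \<bar>b - b'\<bar>"
    unfolding abs_mult[symmetric] by (rule abs_triangle_ineq)
  also have "\<dots> \<le> phi0 * lam / m\<^sup>2 * \<bar>a - a'\<bar> * B + 1 / m * \<bar>b - b'\<bar>"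
    using q_lip b q0[OF a'] B0 pos by (intro add_mono mult_mono) auto
  finally have "\<bar>q a * b - q a' * b'\<bar> \<le> phi0 * lam / m\<^sup>2 * B * \<bar>a - a'\<bar> + \<bar>b - b'\<bar> / m"
    by (simp add: mult_ac)
  then have "\<bar>phi1\<bar> * lam * c0 * \<bar>q a * b - q a' * b'\<bar>
      \<le> \<bar>phi1\<bar> * lam * c0 * (phi0 * lam / m\<^sup>2 * B * \<bar>a - a'\<bar> + \<bar>b - b'\<bar> / m)"
    using pos by (intro mult_left_mono) auto
  moreover have "drift_b lam c0 phi0 phi1 a b - drift_b lam c0 phi0 phi1 a' b'
      = - (phi1 * lam * c0) * (q a * b - q a' * b')"
    unfolding drift by (simp add: algebra_simps)
  ultimately show "\<bar>drift_b lam c0 phi0 phi1 a b - drift_b lam c0 phi0 phi1 a' b'\<bar>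
      \<le> \<bar>phi1\<bar> * lam * c0 * (phi0 * lam / m\<^sup>2 * B * \<bar>a - a'\<bar> + \<bar>b - b'\<bar> / m)"
    by (simp only: abs_minus_cancel mult_minus_left abs_mult[of "phi1 * lam * c0"] absc)
qed

text \<open>The change is split in two: first the upper limit moves at fixed \<open>x\<close>, then
  the parameter moves at fixed \<open>s'\<close>.\<close>

lemma integral_parameter_lipschitz:
  fixes f :: "real \<Rightarrow> real \<Rightarrow> real"
  assumes int: "\<And>x. (\<lambda>r. f r x) integrable_on {0..T}"
    and bdd: "\<And>r x. r \<in> {0..T} \<Longrightarrow> \<bar>f r x\<bar> \<le> B"
    and lip: "\<And>r x y. r \<in> {0..T} \<Longrightarrow> \<bar>f r x - f r y\<bar> \<le> L * \<bar>x - y\<bar>"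
    and s: "s \<in> {0..T}" "s' \<in> {0..T}"
  shows "\<bar>integral {0..s} (\<lambda>r. f r x) - integral {0..s'} (\<lambda>r. f r y)\<bar> \<le> B * \<bar>s - s'\<bar> + L * T * \<bar>x - y\<bar>"
proof -
  have sub: "(\<lambda>r. f r x) integrable_on {0..u}" if "u \<in> {0..T}" for u x
    by (rule integrable_on_subinterval[OF int]) (use that in auto)
  have time: "\<bar>integral {0..u} (\<lambda>r. f r x) - integral {0..v} (\<lambda>r. f r x)\<bar> \<le> B * \<bar>u - v\<bar>"
    if "u \<in> {0..T}" "v \<in> {0..T}" for u v
    using integral_diff_le[OF sub[OF that(1), of x], of v B] integral_diff_le[OF sub[OF that(2), of x], of u B]
      that bdd by (cases "u \<le> v") (auto simp: abs_minus_commute)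
  have L0: "0 \<le> L * \<bar>x - y\<bar>" using lip[of 0 x y] s by (meson abs_ge_zero atLeastAtMost_iff order_trans order_refl)
  have "integral {0..s'} (\<lambda>r. f r x) - integral {0..s'} (\<lambda>r. f r y) = integral {0..s'} (\<lambda>r. f r x - f r y)"
    by (rule Henstock_Kurzweil_Integration.integral_diff[symmetric]) (use sub s in auto)
  also have "\<bar>\<dots>\<bar> \<le> L * \<bar>x - y\<bar> * (s' - 0)"
    by (rule integral_abs_le) (use s lip in auto)
  also have "\<dots> \<le> L * \<bar>x - y\<bar> * T" using L0 s by (intro mult_left_mono) auto
  finally show ?thesis using time[OF s] by (simp add: mult_ac)
qed

lemma bounded_density_powr:
  assumes v: "v \<in> borel_measurable lborel" "\<And>x. 0 \<le> v x" "\<And>x. v x \<le> C"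
    and mass: "(\<integral>\<^sup>+x. ennreal (v x) \<partial>lborel) \<le> 1" and p: "1 < p"
  shows "integrable lborel (\<lambda>x. \<bar>v x\<bar> powr p)" "(\<integral>x. \<bar>v x\<bar> powr p \<partial>lborel) \<le> C powr (p - 1)"
proof -
  have int: "integrable lborel v"
    using v mass by (intro integrableI_nonneg) (auto intro: le_less_trans)
  have "ennreal (\<integral>x. v x \<partial>lborel) \<le> 1"
    using nn_integral_eq_integral[OF int] v(2) mass by simp
  then have int_le: "(\<integral>x. v x \<partial>lborel) \<le> 1" by (simp add: ennreal_le_1)
  have le: "\<bar>v x\<bar> powr p \<le> C powr (p - 1) * v x" for x
  proof (cases "v x = 0")
    case False
    then have "0 < v x" using v(2)[of x] by simp
    then have "\<bar>v x\<bar> powr p = v x powr (p - 1) * v x"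
      by (metis abs_of_pos add.commute diff_add_cancel powr_add powr_one less_imp_le mult.commute)
    also have "\<dots> \<le> C powr (p - 1) * v x"
      using v(3)[of x] \<open>0 < v x\<close> p by (intro mult_right_mono powr_mono2) auto
    finally show ?thesis .
  qed simp
  show int_p: "integrable lborel (\<lambda>x. \<bar>v x\<bar> powr p)"
  proof (rule Bochner_Integration.integrable_bound[of _ "\<lambda>x. C powr (p - 1) * v x"])
    show "integrable lborel (\<lambda>x. C powr (p - 1) * v x)" using int by simp
    show "(\<lambda>x. \<bar>v x\<bar> powr p) \<in> borel_measurable lborel" using v(1) by measurable
    show "AE x in lborel. norm (\<bar>v x\<bar> powr p) \<le> norm (C powr (p - 1) * v x)"
      using le by (intro AE_I2) (smt (verit) norm_powr_real_powr powr_ge_zero real_norm_def)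
  qed
  have "(\<integral>x. \<bar>v x\<bar> powr p \<partial>lborel) \<le> (\<integral>x. C powr (p - 1) * v x \<partial>lborel)"
    by (rule integral_mono[OF int_p]) (use int le in auto)
  also have "\<dots> \<le> C powr (p - 1) * 1"
    using int_le by (simp add: mult_left_le)
  finally show "(\<integral>x. \<bar>v x\<bar> powr p \<partial>lborel) \<le> C powr (p - 1)" by simp
qed

theorem theorem3p1:
  fixes M :: "'a measure"
    and T lam c0 phi0 phi1 m Mb M_K M_K' M_K'' L_K L_K' :: real
    and K rho0 :: "real \<Rightarrow> real"
    and X0 Z :: "'a \<Rightarrow> real"
    and W :: "real \<Rightarrow> 'a \<Rightarrow> real"
    and X :: "real \<Rightarrow> 'a \<Rightarrow> real option"
    and \<tau> :: "'a \<Rightarrow> ereal"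
  assumes T_pos: "T > 0"
    and BM: "brownian_motion M W"
    and X0_law: "distributed M lborel X0 (\<lambda>x. ennreal (rho0 x))"
    and X0_L2: "integrable M (\<lambda>\<omega>. (X0 \<omega>)\<^sup>2)"
    and rho0_L2: "integrable lborel (\<lambda>x. (rho0 x)\<^sup>2)"
    and rho0_cont: "continuous_on UNIV rho0"
    and rho0_bdd: "bounded (range rho0)"
    and Z_law: "distributed M lborel Z (\<lambda>x. ennreal (exponential_density 1 x))"
    and indep: "prob_space.indep_sets M
                  (\<lambda>i::nat. if i = 0 then sets (vimage_algebra (space M) X0 borel)
                         else if i = 1 then sets (vimage_algebra (space M) Z borel)
                         else sets (vimage_algebra (space M) (\<lambda>\<omega> t. W t \<omega>)
                                      (Pi\<^sub>M UNIV (\<lambda>_. borel))))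
                  {0, 1, 2}"
    and K_smooth: "\<forall>n x. ((deriv ^^ n) K) differentiable (at x)"
    and K_nonneg: "\<forall>x. K x \<ge> 0"
    and K_bdd: "\<forall>x. \<bar>K x\<bar> \<le> M_K"
    and DK_bdd: "\<forall>x. \<bar>deriv K x\<bar> \<le> M_K'"
    and D2K_bdd: "\<forall>x. \<bar>deriv (deriv K) x\<bar> \<le> M_K''"
    and K_lip: "\<forall>x y. \<bar>K x - K y\<bar> \<le> L_K * \<bar>x - y\<bar>"
    and DK_lip: "\<forall>x y. \<bar>deriv K x - deriv K y\<bar> \<le> L_K' * \<bar>x - y\<bar>"
    and K_int: "integrable lborel K" "(\<integral>x. K x \<partial>lborel) = 1"
    and lam_pos: "lam > 0" and c0_pos: "c0 > 0" and phi0_pos: "phi0 > 0"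
    and m_pos: "0 < m" and m_le_Mb: "m \<le> Mb"
    and phi_bounds: "\<forall>x\<in>{0..M_K * T}. m \<le> phi0 + phi1 * c0 * exp (- lam * x)
                                        \<and> phi0 + phi1 * c0 * exp (- lam * x) \<le> Mb"
    and sol: "killed_MV_solution M T K lam c0 phi0 phi1 X0 W Z X \<tau>"
  shows "\<exists>v :: real \<Rightarrow> real \<Rightarrow> real.
           (\<forall>t\<in>{0<..T}. v t \<in> borel_measurable lborel \<and> (\<forall>x. 0 \<le> v t x) \<and>
                killed_law M X t = density lborel (\<lambda>x. ennreal (v t x))) \<and>
           (\<forall>p::real. 1 < p \<longrightarrow>
              (\<forall>t\<in>{0<..T}. integrable lborel (\<lambda>x. \<bar>v t x\<bar> powr p)) \<and>
              (\<forall>\<epsilon>\<in>{0<..T}. \<exists>C. \<forall>t\<in>{\<epsilon>..T}.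
                  (\<integral>x. \<bar>v t x\<bar> powr p \<partial>lborel) powr (1 / p) \<le> C))"
proof -

  \<comment> \<open>The equation path by path\<close>
  interpret prob_space M using BM by (simp add: brownian_motion_def)
  let ?nu = "killed_law M X"
  define A where "A s \<omega> = ext_cem (\<lambda>x. integral {0..s} (\<lambda>r. conv_meas K (?nu r) x)) (X s \<omega>)" for s \<omega>
  define B where "B s \<omega> = ext_cem (\<lambda>x. integral {0..s} (\<lambda>r. conv_meas (deriv K) (?nu r) x)) (X s \<omega>)" for s \<omega>
  define D where "D s \<omega> = drift_b lam c0 phi0 phi1 (A s \<omega>) (B s \<omega>)" for s \<omega>
  \<comment> \<open>Almost surely this is the path of \<open>X\<close> before \<open>\<tau>\<close>.
    At the cemetery \<open>A\<close> and \<open>B\<close> are 0 and the drift vanishes, so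
    \<open>Y\<close> is a real-valued continuation to all of \<open>{0..T}\<close>.\<close>
  define Y where "Y s \<omega> = X0 \<omega> + integral {0..s} (\<lambda>s. D s \<omega>) + sqrt 2 * W s \<omega>" for s \<omega>
  have meas: "\<forall>S\<in>sets borel. {\<omega> \<in> space M. X t \<omega> \<in> Some ` S} \<in> events" if "t \<in> {0..T}" for t
    using sol that unfolding killed_MV_solution_def Let_def by blast
  have path: "AE \<omega> in M. \<forall>t\<in>{0..T}. (ereal t < \<tau> \<omega> \<longrightarrow> X t \<omega> = Some (Y t \<omega>)) \<and>
      (\<tau> \<omega> \<le> ereal t \<longrightarrow> X t \<omega> = None)"
  proof -
    have "AE \<omega> in M. \<tau> \<omega> = Inf {ereal t | t. t \<in> {0..T} \<and>
                    integral {0..t} (\<lambda>s. lam * c0 * exp (- lam * A s \<omega>)) \<ge> Z \<omega>} \<and>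
          (\<forall>t\<in>{0..T}. (ereal t < \<tau> \<omega> \<longrightarrow> X t \<omega> = Some (Y t \<omega>)) \<and>
             (\<tau> \<omega> \<le> ereal t \<longrightarrow> X t \<omega> = None))"
      using sol unfolding killed_MV_solution_def Let_def Y_def D_def A_def B_def by (rule conjunct2)
    then show ?thesis by (rule eventually_mono) (rule conjunct2)
  qed
  have W_cont: "AE \<omega> in M. continuous_on {0..} (\<lambda>t. W t \<omega>)"
  proof -
    have "AE \<omega> in M. W 0 \<omega> = 0 \<and> continuous_on {0..} (\<lambda>t. W t \<omega>)"
      using BM unfolding brownian_motion_def by blast
    then show ?thesis by (rule eventually_mono) (rule conjunct2)
  qed
  have K_cont: "continuous_on UNIV K" "continuous_on UNIV (deriv K)"
    by (rule continuous_on_abs_lipschitz, rule K_lip[rule_format])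
      (rule continuous_on_abs_lipschitz, rule DK_lip[rule_format])
  then have K_meas: "K \<in> borel_measurable borel" "deriv K \<in> borel_measurable borel"
    by (auto intro: borel_measurable_continuous_onI)
  have L_nonneg: "0 \<le> L_K" "0 \<le> L_K'" using K_lip[rule_format, of 0 1] DK_lip[rule_format, of 0 1] by auto
  have M_nonneg: "0 \<le> M_K" "0 \<le> M_K'"
    using K_bdd[rule_format, of 0] DK_bdd[rule_format, of 0] by linarith+
  note conv_K = conv_meas_killed_law_bounds[OF meas K_meas(1) K_bdd[rule_format]]
  note conv_DK = conv_meas_killed_law_bounds[OF meas K_meas(2) DK_bdd[rule_format]]

  \<comment> \<open>The drift as a function of time and state\<close>
  define a where "a s x = integral {0..s} (\<lambda>r. conv_meas K (?nu r) x)" for s x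
  define b where "b s x = integral {0..s} (\<lambda>r. conv_meas (deriv K) (?nu r) x)" for s x
  define g where "g s x = drift_b lam c0 phi0 phi1 (a s x) (b s x)" for s x
  have a_range: "a s x \<in> {0..M_K * T}" if s: "s \<in> {0..T}" for s x
  proof -
    have "\<bar>a s x\<bar> \<le> M_K * (s - 0)"
      unfolding a_def by (rule integral_abs_le) (use s conv_K(1) in auto)
    also have "\<dots> \<le> M_K * T" using s M_nonneg by (intro mult_left_mono) auto
    finally have "\<bar>a s x\<bar> \<le> M_K * T" .
    \<comment> \<open>Integrability in \<open>r\<close> is not yet available at this point; the
      default value 0 lies in the required range too.\<close>
    moreover have "0 \<le> a s x"
    proof (cases "(\<lambda>r. conv_meas K (?nu r) x) integrable_on {0..s}")
      case True
      then show ?thesis unfolding a_def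
        by (rule Henstock_Kurzweil_Integration.integral_nonneg) (use s conv_K(2) K_nonneg in auto)
    next
      case False
      then show ?thesis by (simp add: a_def not_integrable_integral)
    qed
    ultimately show ?thesis by auto
  qed
  have b_range: "\<bar>b s x\<bar> \<le> M_K' * T" if s: "s \<in> {0..T}" for s x
  proof -
    have "\<bar>b s x\<bar> \<le> M_K' * (s - 0)"
      unfolding b_def by (rule integral_abs_le) (use s conv_DK(1) in auto)
    also have "\<dots> \<le> M_K' * T" using s M_nonneg by (intro mult_left_mono) auto
    finally show ?thesis .
  qed
  have phi_lb: "m \<le> phi0 + phi1 * c0 * exp (- lam * x)" if "x \<in> {0..M_K * T}" for x
    using phi_bounds that by blast
  note drift = drift_b_bounds[OF lam_pos c0_pos phi0_pos m_pos phi_lb]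
  have D_bdd: "\<bar>D s \<omega>\<bar> \<le> \<bar>phi1\<bar> * lam * c0 * (M_K' * T) / m" if s: "s \<in> {0..T}" for s \<omega>
    unfolding D_def
  proof (rule drift(1))
    show "A s \<omega> \<in> {0..M_K * T}"
      using a_range[OF s] M_nonneg T_pos
      by (cases "X s \<omega>") (auto simp: A_def ext_cem_def a_def)
    show "\<bar>B s \<omega>\<bar> \<le> M_K' * T"
      using b_range[OF s] M_nonneg T_pos
      by (cases "X s \<omega>") (auto simp: B_def ext_cem_def b_def)
  qed
  \<comment> \<open>Of the drift this uses only the bound \<open>D_bdd\<close>, so it can precede
    \<open>conv_int\<close>, which is derived from it, without circularity.\<close>
  have Y_reg: "regulated_on 0 T (\<lambda>s. Y s \<omega>)" if "continuous_on {0..} (\<lambda>t. W t \<omega>)" for \<omega>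
    unfolding Y_def
    by (intro regulated_on_add regulated_on_integral[OF D_bdd] regulated_on_continuous
        continuous_intros continuous_on_subset[OF that]) auto

  \<comment> \<open>Integrability in time of the convolutions\<close>
  have conv_int: "(\<lambda>r. conv_meas k (?nu r) x) integrable_on {0..T}"
    if k: "continuous_on UNIV k" "\<forall>x. \<bar>k x\<bar> \<le> c" for k c x
  proof -
    have km: "k \<in> borel_measurable borel" by (rule borel_measurable_continuous_onI[OF k(1)])
    let ?F = "\<lambda>r \<omega>. ext_cem (\<lambda>y. k (x - y)) (X r \<omega>)"
    have c0: "0 \<le> c" using k(2)[rule_format, of 0] by linarith
    have "regulated_on 0 T (\<lambda>r. expectation (?F r))"
    proof (rule regulated_on_expectation)
      show "?F r \<in> borel_measurable M" if "r \<in> {0..T}" for r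
        by (rule conv_meas_killed_law(1)[where X=X and M=M and t=r, OF meas[OF that] km])
      show "\<bar>?F r \<omega>\<bar> \<le> c" for r \<omega>
        using k(2) c0 by (auto simp: ext_cem_def split: option.split)
      show "AE \<omega> in M. regulated_on 0 T (\<lambda>r. ?F r \<omega>)"
        using path W_cont
      proof eventually_elim
        case (elim \<omega>)
        have "continuous_on UNIV (\<lambda>y. k (x - y))"
          by (intro continuous_on_compose2[OF k(1)] continuous_intros) auto
        from regulated_on_kill[OF regulated_on_compose[OF Y_reg[OF elim(2)] this], of "\<tau> \<omega>"]
        have "regulated_on 0 T (\<lambda>r. if ereal r < \<tau> \<omega> then k (x - Y r \<omega>) else 0)" .
        moreover have "(if ereal r < \<tau> \<omega> then k (x - Y r \<omega>) else 0) = ?F r \<omega>" if "0 \<le> r" "r \<le> T" for r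
          using elim(1) that by (auto simp: ext_cem_def not_less)
        ultimately show ?case by (subst (asm) regulated_on_cong)
      qed
    qed
    moreover have "conv_meas k (?nu r) x = expectation (?F r)" if "0 \<le> r" "r \<le> T" for r
      by (rule conv_meas_killed_law(2)[where X=X and M=M and t=r, OF meas km]) (use that in simp)
    ultimately have "regulated_on 0 T (\<lambda>r. conv_meas k (?nu r) x)"
      by (subst regulated_on_cong)
    then show ?thesis by (rule regulated_on_integrable)
  qed

  \<comment> \<open>Lipschitz continuity of the drift\<close>
  define La where "La = M_K + L_K * T"
  define Lb where "Lb = M_K' + L_K' * T"
  \<comment> \<open>\<open>La\<close> and \<open>Lb\<close> are Lipschitz constants of
    \<open>a\<close> and \<open>b\<close>: the bound of the integrand serves for time, its Lipschitz
    constant times \<open>T\<close> for the state. \<open>L\<close> results from inserting them into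
    \<open>drift(2)\<close>.\<close>
  define L where "L = \<bar>phi1\<bar> * lam * c0 * (phi0 * lam / m\<^sup>2 * (M_K' * T) * La + Lb / m)"
  have L0: "0 \<le> L"
    using lam_pos c0_pos phi0_pos m_pos T_pos M_nonneg L_nonneg by (auto simp: L_def La_def Lb_def)
  have g_lip: "\<bar>g s y - g s' y'\<bar> \<le> L * (\<bar>s - s'\<bar> + \<bar>y - y'\<bar>)"
    if s: "s \<in> {0..T}" "s' \<in> {0..T}" for s s' y y'
  proof -
    let ?d = "\<bar>s - s'\<bar> + \<bar>y - y'\<bar>"
    have "\<bar>a s y - a s' y'\<bar> \<le> M_K * \<bar>s - s'\<bar> + L_K * T * \<bar>y - y'\<bar>"
      unfolding a_def
      by (rule integral_parameter_lipschitz[OF conv_int[OF K_cont(1) K_bdd] conv_K(1) conv_K(3) s])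
        (use K_lip in auto)
    also have "\<dots> \<le> La * ?d"
      using M_nonneg L_nonneg T_pos by (simp add: La_def algebra_simps)
    finally have da: "\<bar>a s y - a s' y'\<bar> \<le> La * ?d" .
    have "\<bar>b s y - b s' y'\<bar> \<le> M_K' * \<bar>s - s'\<bar> + L_K' * T * \<bar>y - y'\<bar>"
      unfolding b_def
      by (rule integral_parameter_lipschitz[OF conv_int[OF K_cont(2) DK_bdd] conv_DK(1) conv_DK(3) s])
        (use DK_lip in auto)
    also have "\<dots> \<le> Lb * ?d"
      using M_nonneg L_nonneg T_pos by (simp add: Lb_def algebra_simps)
    finally have db: "\<bar>b s y - b s' y'\<bar> \<le> Lb * ?d" .
    have "\<bar>g s y - g s' y'\<bar> \<le> \<bar>phi1\<bar> * lam * c0 *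
        (phi0 * lam / m\<^sup>2 * (M_K' * T) * \<bar>a s y - a s' y'\<bar> + \<bar>b s y - b s' y'\<bar> / m)"
      unfolding g_def by (rule drift(2)[OF _ a_range b_range a_range]) (use s in auto)
    also have "\<dots> \<le> \<bar>phi1\<bar> * lam * c0 * (phi0 * lam / m\<^sup>2 * (M_K' * T) * (La * ?d) + Lb * ?d / m)"
      using da db lam_pos c0_pos phi0_pos m_pos T_pos M_nonneg
      by (intro mult_left_mono add_mono divide_right_mono) auto
    also have "\<dots> = L * ?d" by (simp add: L_def field_simps)
    finally show ?thesis .
  qed
  have g_cont: "continuous_on ({0..T} \<times> UNIV) (\<lambda>p. g (fst p) (snd p))"
  proof (rule lipschitz_on_continuous_on, rule lipschitz_onI)
    fix p q :: "real \<times> real" assume "p \<in> {0..T} \<times> UNIV" "q \<in> {0..T} \<times> UNIV"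
    then have "dist (g (fst p) (snd p)) (g (fst q) (snd q)) \<le> L * (dist (fst p) (fst q) + dist (snd p) (snd q))"
      using g_lip[of "fst p" "fst q" "snd p" "snd q"] by (auto simp: dist_real_def)
    also have "\<dots> \<le> L * (dist p q + dist p q)"
      by (intro mult_left_mono add_mono dist_fst_le dist_snd_le L0)
    finally show "dist (g (fst p) (snd p)) (g (fst q) (snd q)) \<le> (2 * L) * dist p q" by simp
  qed (use L0 in simp)

  \<comment> \<open>Pathwise convergence of the Euler scheme\<close>
  define E where "E t n \<omega> = euler g (t / real n) (\<lambda>s. sqrt 2 * W s \<omega>) (X0 \<omega>) n" for t n \<omega>
  have E_tendsto: "AE \<omega> in M. \<forall>t\<in>{0<..T}. \<forall>y. X t \<omega> = Some y \<longrightarrow> (\<lambda>n. E t n \<omega>) \<longlonglongrightarrow> y"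
    using path W_cont
  proof eventually_elim
    case (elim \<omega>)
    show ?case
    proof safe
      fix t y assume t: "t \<in> {0<..T}" and y: "X t \<omega> = Some y"
      \<comment> \<open>Survival at time \<open>t\<close> entails survival on all of
        \<open>{0..t}\<close>, where the random drift \<open>D s\<close> is therefore
        \<open>g\<close> evaluated along \<open>Y\<close>.\<close>
      have "ereal t < \<tau> \<omega>" using elim(1) t y by (metis atLeastAtMost_iff greaterThanAtMost_iff less_imp_le not_less option.distinct(1))
      then have "X s \<omega> = Some (Y s \<omega>)" if "s \<in> {0..t}" for s
        using elim(1) that t by (auto dest!: le_less_trans[of "ereal s" "ereal t" "\<tau> \<omega>", rotated])
      then have D_eq: "D s \<omega> = g s (Y s \<omega>)" if "s \<in> {0..t}" for s
        using that by (simp add: D_def A_def B_def ext_cem_def g_def a_def b_def)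
      have Xt: "Y t \<omega> = y" using \<open>\<And>s. s \<in> {0..t} \<Longrightarrow> X s \<omega> = Some (Y s \<omega>)\<close>[of t] t y by simp
      \<comment> \<open>The integrand is now known to be integrable, so the integral in
        \<open>Y\<close> is a genuine one and \<open>Y\<close> is continuous on
        \<open>{0..t}\<close>, as \<open>euler_tendsto\<close> requires.\<close>
      have "regulated_on 0 t (\<lambda>s. g s (Y s \<omega>))"
        by (rule regulated_on_compose2[OF regulated_on_subinterval[OF Y_reg[OF elim(2)]] continuous_on_subset[OF g_cont]])
          (use t in auto)
      then have gY_int: "(\<lambda>s. g s (Y s \<omega>)) integrable_on {0..t}" by (rule regulated_on_integrable)
      have int_eq: "integral {0..s} (\<lambda>s. D s \<omega>) = integral {0..s} (\<lambda>s. g s (Y s \<omega>))" if "s \<in> {0..t}" for s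
        by (rule Henstock_Kurzweil_Integration.integral_cong) (use D_eq that in auto)
      have Y_eq: "Y s \<omega> = X0 \<omega> + integral {0..s} (\<lambda>u. g u (Y u \<omega>)) + sqrt 2 * W s \<omega>" if "s \<in> {0..t}" for s
        unfolding int_eq[OF that, symmetric] by (simp add: Y_def)
      have "continuous_on {0..t} (\<lambda>s. X0 \<omega> + integral {0..s} (\<lambda>u. g u (Y u \<omega>)) + sqrt 2 * W s \<omega>)"
        by (intro continuous_intros indefinite_integral_continuous_1[OF gY_int] continuous_on_subset[OF elim(2)]) auto
      then have "continuous_on {0..t} (\<lambda>s. Y s \<omega>)"
        by (rule continuous_on_eq) (use Y_eq in simp)
      then show "(\<lambda>n. E t n \<omega>) \<longlonglongrightarrow> y"
        unfolding E_def Xt[symmetric]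
        by (rule euler_tendsto[rotated 3]) (use t L0 g_lip Y_eq in auto)
    qed
  qed

  \<comment> \<open>Uniform bound on the law of \<open>X t\<close>\<close>
  obtain R where R: "\<And>x. \<bar>rho0 x\<bar> \<le> R" using rho0_bdd by (auto simp: bounded_iff)
  have R0: "0 \<le> R" using R[of 0] by linarith
  have rv_X0: "X0 \<in> borel_measurable M" using X0_law by (auto simp: distributed_def)
  have rv_W: "(\<lambda>\<omega> s. W s \<omega>) \<in> measurable M (Pi\<^sub>M UNIV (\<lambda>_. borel))"
    using BM by (intro measurable_PiM_single') (auto simp: brownian_motion_def)
  have X0_W: "prob ((X0 -` P \<inter> space M) \<inter> ((\<lambda>\<omega> s. W s \<omega>) -` Q \<inter> space M))
      = prob (X0 -` P \<inter> space M) * prob ((\<lambda>\<omega> s. W s \<omega>) -` Q \<inter> space M)"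
    if PQ: "P \<in> sets borel" "Q \<in> sets (Pi\<^sub>M UNIV (\<lambda>_. borel))" for P Q
  proof -
    \<comment> \<open>Independence is used on the index subset \<open>{0, 2}\<close>, which carries
      the sigma-algebras of \<open>X0\<close> and \<open>W\<close>.\<close>
    let ?S = "\<lambda>i::nat. if i = 0 then X0 -` P \<inter> space M else (\<lambda>\<omega> s. W s \<omega>) -` Q \<inter> space M"
    have "prob (\<Inter>j\<in>{0, 2}. ?S j) = (\<Prod>j\<in>{0, 2}. prob (?S j))"
      by (rule indep_setsD[OF indep]) (use PQ in \<open>auto intro: in_vimage_algebra\<close>)
    then show ?thesis by (simp add: Int_commute)
  qed
  \<comment> \<open>A factor 2 comes from \<open>euler_prob_interval\<close>. For large
    \<open>n\<close> the expansion factor \<open>(1 - t * L / n) ^ n\<close> exceeds half its limit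
    \<open>exp (- (t * L))\<close>, which yields another 2 and the exponential.\<close>
  define C where "C = R * (4 * exp (T * L))"
  have C0: "0 \<le> C" using R0 by (simp add: C_def)
  \<comment> \<open>Open intervals come first: if \<open>X t\<close> lies in one, so do the Euler
    values for all large \<open>n\<close>, and Fatou transfers their bound to the limit.\<close>
  have interval: "emeasure (?nu t) {u<..<v} \<le> ennreal (C * (v - u))" if t: "t \<in> {0<..T}" and uv: "u < v" for t u v
  proof -
    define S where "S n = {\<omega> \<in> space M. E t n \<omega> \<in> {u<..<v}}" for n
    have step_mem: "real k * (t / real n) \<in> {0..T}" if "k < n" for k n :: nat
    proof -
      have "real k * (t / real n) \<le> real n * (t / real n)"
        using that t by (intro mult_right_mono) auto
      then show ?thesis using that t by auto
    qed
    have lip: "\<bar>g (real k * (t / real n)) y - g (real k * (t / real n)) y'\<bar> \<le> L * \<bar>y - y'\<bar>"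
      if "k < n" for k n y y'
      using g_lip[OF step_mem[OF that] step_mem[OF that], of y y'] by simp
    have "E t n \<in> borel_measurable M" for n
      unfolding E_def[abs_def]
      by (rule euler_random_variable[OF rv_X0 rv_W]) (rule continuous_on_abs_lipschitz, rule lip)
    then have S: "S n \<in> events" for n unfolding S_def by measurable
    have "(\<lambda>n. (1 + (- (t * L)) / real n) ^ n) \<longlonglongrightarrow> exp (- (t * L))"
      by (rule tendsto_exp_limit_sequentially)
    then have "eventually (\<lambda>n. exp (- (t * L)) / 2 < (1 + (- (t * L)) / real n) ^ n) sequentially"
      by (rule order_tendstoD(1)) simp
    \<comment> \<open>This makes the step size admissible, \<open>h * L < 1\<close>, and excludes
      \<open>n = 0\<close>.\<close>
    moreover have "eventually (\<lambda>n. t * L < real n) sequentially"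
      using filterlim_real_sequentially by (simp add: filterlim_at_top_dense)
    ultimately have S_le: "eventually (\<lambda>n. emeasure M (S n) \<le> ennreal (C * (v - u))) sequentially"
    proof eventually_elim
      case (elim n)
      have n: "0 < real n" using elim(2) L0 t by (smt (verit) greaterThanAtMost_iff mult_nonneg_nonneg)
      let ?q = "(1 - t / real n * L) ^ n"
      have q: "exp (- (t * L)) / 2 < ?q" using elim(1) by simp
      have "exp (- (T * L)) \<le> exp (- (t * L))" using t L0 by (simp add: mult_right_mono)
      then have q_ge: "exp (- (T * L)) / 2 \<le> ?q" using q by linarith
      have "0 < exp (- (T * L)) / 2" by simp
      then have q_pos: "0 < ?q" using q_ge by (rule less_le_trans)
      have "2 * (v - u) / ?q \<le> 2 * (v - u) / (exp (- (T * L)) / 2)"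
        by (rule divide_left_mono[OF q_ge]) (use uv q_pos in \<open>auto intro!: mult_pos_pos\<close>)
      also have "\<dots> = 4 * exp (T * L) * (v - u)" by (simp add: exp_minus field_simps)
      finally have q_le: "2 * (v - u) / ?q \<le> 4 * exp (T * L) * (v - u)" .
      have "emeasure M (S n) \<le> ennreal R * ennreal (2 * (v - u) / ?q)"
        unfolding S_def E_def
      proof (rule euler_prob_interval[OF rv_X0 rv_W X0_W X0_law])
        show "rho0 x \<le> R" for x using R[of x] by linarith
        show "t / real n * L < 1" using elim(2) n by (simp add: field_simps)
      qed (use t uv lip in auto)
      also have "\<dots> \<le> ennreal R * ennreal (4 * exp (T * L) * (v - u))"
        by (intro mult_left_mono ennreal_leI q_le) simp
      also have "\<dots> = ennreal (C * (v - u))"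
        using R0 uv by (simp add: C_def ennreal_mult[symmetric] mult.assoc)
      finally show ?case .
    qed
    have X_meas: "{\<omega> \<in> space M. X t \<omega> \<in> Some ` {u<..<v}} \<in> events" using meas[of t] t by auto
    have "emeasure (?nu t) {u<..<v} = (\<integral>\<^sup>+\<omega>. indicator {\<omega> \<in> space M. X t \<omega> \<in> Some ` {u<..<v}} \<omega> \<partial>M)"
      using meas[of t] t X_meas by (simp add: emeasure_killed_law)
    also have "\<dots> \<le> (\<integral>\<^sup>+\<omega>. liminf (\<lambda>n. indicator (S n) \<omega>) \<partial>M)"
    proof (rule nn_integral_mono_AE)
      show "AE \<omega> in M. (indicator {\<omega> \<in> space M. X t \<omega> \<in> Some ` {u<..<v}} \<omega> :: ennreal)
          \<le> liminf (\<lambda>n. indicator (S n) \<omega>)"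
        using E_tendsto
      proof eventually_elim
        case (elim \<omega>)
        show ?case
        proof (cases "\<omega> \<in> space M \<and> X t \<omega> \<in> Some ` {u<..<v}")
          case True
          then obtain y where y: "X t \<omega> = Some y" "u < y" "y < v" by auto
          have lim: "(\<lambda>n. E t n \<omega>) \<longlonglongrightarrow> y" using elim t y(1) by blast
          have "eventually (\<lambda>n. E t n \<omega> \<in> {u<..<v}) sequentially"
            using order_tendstoD[OF lim] y by (auto intro: eventually_conj)
          then have "eventually (\<lambda>n. (1::ennreal) \<le> indicator (S n) \<omega>) sequentially"
            by (rule eventually_mono) (use True in \<open>auto simp: S_def\<close>)
          then have "liminf (\<lambda>_. 1::ennreal) \<le> liminf (\<lambda>n. indicator (S n) \<omega>)" by (rule Liminf_mono)
          then show ?thesis using True by (simp add: Liminf_const)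
        next
          case False
          then show ?thesis by (auto simp: indicator_def)
        qed
      qed
    qed
    also have "\<dots> \<le> liminf (\<lambda>n. \<integral>\<^sup>+\<omega>. indicator (S n) \<omega> \<partial>M)"
      by (rule nn_integral_liminf) (use S in auto)
    also have "\<dots> = liminf (\<lambda>n. emeasure M (S n))" using S by simp
    also have "\<dots> \<le> liminf (\<lambda>n. ennreal (C * (v - u)))" by (rule Liminf_mono[OF S_le])
    also have "\<dots> = ennreal (C * (v - u))" by (simp add: Liminf_const)
    finally show ?thesis .
  qed
  \<comment> \<open>A closed interval is enlarged to an open one by \<open>d\<close> on each side,
    and \<open>d\<close> tends to 0.\<close>
  have closed: "emeasure (?nu t) {u..v} \<le> ennreal (C * (v - u))" if t: "t \<in> {0<..T}" and uv: "u \<le> v" for t u v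
  proof -
    have "((\<lambda>d. ennreal (C * ((v + d) - (u - d)))) \<longlongrightarrow> ennreal (C * ((v + 0) - (u - 0)))) (at_right 0)"
      by (intro tendsto_intros)
    moreover have "emeasure (?nu t) {u..v} \<le> ennreal (C * ((v + d) - (u - d)))" if "0 < d" for d
    proof -
      have "emeasure (?nu t) {u..v} \<le> emeasure (?nu t) {u - d<..<v + d}"
        by (rule emeasure_mono) (use that in \<open>auto simp: sets_killed_law\<close>)
      also have "\<dots> \<le> ennreal (C * ((v + d) - (u - d)))"
        by (rule interval[OF t]) (use uv that in simp)
      finally show ?thesis .
    qed
    ultimately have "emeasure (?nu t) {u..v} \<le> ennreal (C * ((v + 0) - (u - 0)))"
      by (intro tendsto_lowerbound[where F="at_right 0"]) (auto simp: eventually_at_filter)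
    then show ?thesis by simp
  qed

  \<comment> \<open>Densities and their Lp norms\<close>
  have "\<exists>v. v \<in> borel_measurable borel \<and> (\<forall>x. 0 \<le> v x) \<and> (\<forall>x. v x \<le> C) \<and>
      ?nu t = density lborel (\<lambda>x. ennreal (v x))" if t: "t \<in> {0<..T}" for t
    using bounded_density_exists[OF sets_killed_law C0 emeasure_le_lborel[OF sets_killed_law C0 closed[OF t]]]
    by metis
  then obtain v where v_all: "\<forall>t\<in>{0<..T}. v t \<in> borel_measurable borel \<and> (\<forall>x. 0 \<le> v t x) \<and>
      (\<forall>x. v t x \<le> C) \<and> ?nu t = density lborel (\<lambda>x. ennreal (v t x))"
    by metis
  have v: "v t \<in> borel_measurable borel" "\<And>x. 0 \<le> v t x" "\<And>x. v t x \<le> C"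
      "?nu t = density lborel (\<lambda>x. ennreal (v t x))" if "t \<in> {0<..T}" for t
    using v_all that by blast+
  have mass: "(\<integral>\<^sup>+x. ennreal (v t x) \<partial>lborel) \<le> 1" if t: "t \<in> {0<..T}" for t
  proof -
    have "(\<integral>\<^sup>+x. ennreal (v t x) \<partial>lborel) = emeasure (?nu t) UNIV"
      unfolding v(4)[OF t] using v(1)[OF t] by (subst emeasure_density) auto
    also have "\<dots> = emeasure M {\<omega> \<in> space M. X t \<omega> \<in> Some ` UNIV}"
      using meas[of t] t by (intro emeasure_killed_law) auto
    also have "\<dots> \<le> 1" by (rule emeasure_le_1)
    finally show ?thesis .
  qed
  have v': "v t \<in> borel_measurable lborel" if "t \<in> {0<..T}" for t using v(1)[OF that] by simp
  note Lp = bounded_density_powr[OF v' v(2) v(3) mass]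
  show ?thesis
  proof (intro exI[of _ v] conjI ballI allI impI)
    fix p :: real and \<epsilon> assume p: "1 < p" and \<epsilon>: "\<epsilon> \<in> {0<..T}"
    \<comment> \<open>The constant \<open>C\<close> bounds \<open>v t\<close> for all
      \<open>t\<close> in \<open>{0<..T}\<close> at once, so the right-hand side does not depend on
      \<open>t\<close>.\<close>
    have "(\<integral>x. \<bar>v t x\<bar> powr p \<partial>lborel) powr (1 / p) \<le> (C powr (p - 1)) powr (1 / p)"
      if t: "t \<in> {\<epsilon>..T}" for t
      by (rule powr_mono2) (use Lp(2)[of t p] t \<epsilon> p in auto)
    then show "\<exists>C. \<forall>t\<in>{\<epsilon>..T}. (\<integral>x. \<bar>v t x\<bar> powr p \<partial>lborel) powr (1 / p) \<le> C" by blast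
  qed (use v v' Lp(1) in auto)
qed

end
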